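(* Let $\mathcal{H}$ be a complex Hilbert space and let $T$ be a bounded linear operator on $\mathcal{H}$ that is absolute-$(p,r)$-paranormal for some real numbers $p,r>0$. If there exists a positive integer $n$ such that $T^n$ is normal, then $T$ is normal.
   Context: For a bounded linear operator $T$ on a complex Hilbert space $\mathcal{H}$, $|T|=(T^*T)^{1/2}$ and $|T^*|=(TT^* )^{1/2}$; real positive powers of positive operators are defined by functional calculus. For $p,r>0$, $T$ is called absolute-$(p,r)$-paranormal if $\| |T|^p |T^*|^r x \|^r \geq \| |T^*|^r x \|^{p+r}$ for every unit vector $x\in\mathcal{H}$ (equivalently, $\| |T|^p |T^*|^r x \|^r\|x\|^p \geq \| |T^*|^r x \|^{p+r}$ for all $x\in\mathcal{H}$). An operator $A$ is normal if $A^*A=AA^*$. The Hilbert space is not assumed to be separable. *)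

theory Defs
  imports "HOL-Analysis.Analysis" "HOL-Computational_Algebra.Polynomial"
begin

text \<open>
  A complex inner product space is a real one whose real inner product is the real part of the
  complex inner product; norm, metric and topology are thus those of the complex inner product.
  The inner product is linear in its first argument. The zero space is allowed.
\<close>

class complex_vector = real_vector +
  fixes scaleC :: "complex \<Rightarrow> 'a \<Rightarrow> 'a"  (infixr "*\<^sub>C" 75)
  assumes scaleC_add_right: "a *\<^sub>C (x + y) = a *\<^sub>C x + a *\<^sub>C y"
    and scaleC_add_left: "(a + b) *\<^sub>C x = a *\<^sub>C x + b *\<^sub>C x"
    and scaleC_scaleC: "a *\<^sub>C b *\<^sub>C x = (a * b) *\<^sub>C x"
    and scaleC_of_real: "complex_of_real t *\<^sub>C x = t *\<^sub>R x"

class complex_inner = complex_vector + real_inner +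
  fixes cinner :: "'a \<Rightarrow> 'a \<Rightarrow> complex"
  assumes cinner_commute: "cinner x y = cnj (cinner y x)"
    and cinner_add_left: "cinner (x + y) z = cinner x z + cinner y z"
    and cinner_scaleC_left: "cinner (a *\<^sub>C x) y = a * cinner x y"
    and inner_eq_Re_cinner: "inner x y = Re (cinner x y)"

class complex_hilbert_space = complex_inner + complete_space

text \<open>
  The type \<open>'a \<Rightarrow>\<^sub>L 'a\<close> consists of the bounded real-linear maps, with the operator
  norm. The bounded operators of the complex space are those satisfying the following predicate.
\<close>

definition complex_linear :: "('a::complex_vector \<Rightarrow> 'b::complex_vector) \<Rightarrow> bool" where
  "complex_linear f \<longleftrightarrow>
     (\<forall>x y. f (x + y) = f x + f y) \<and> (\<forall>c x. f (c *\<^sub>C x) = c *\<^sub>C f x)"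

definition adj :: "('a::complex_hilbert_space \<Rightarrow>\<^sub>L 'a) \<Rightarrow> ('a \<Rightarrow>\<^sub>L 'a)" where
  "adj T = (THE S :: 'a \<Rightarrow>\<^sub>L 'a. \<forall>x y. cinner (T x) y = cinner x (S y))"

definition normal_op :: "('a::complex_hilbert_space \<Rightarrow>\<^sub>L 'a) \<Rightarrow> bool" where
  "normal_op A \<longleftrightarrow> adj A o\<^sub>L A = A o\<^sub>L adj A"

primrec op_power :: "('a::real_normed_vector \<Rightarrow>\<^sub>L 'a) \<Rightarrow> nat \<Rightarrow> ('a \<Rightarrow>\<^sub>L 'a)" where
  "op_power T 0 = id_blinfun"
| "op_power T (Suc n) = T o\<^sub>L op_power T n"

definition op_poly :: "real poly \<Rightarrow> ('a::real_normed_vector \<Rightarrow>\<^sub>L 'a) \<Rightarrow> ('a \<Rightarrow>\<^sub>L 'a)" where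
  "op_poly q A = (\<Sum>i\<le>degree q. coeff q i *\<^sub>R op_power A i)"

text \<open>
  For a complex-linear \<open>T\<close>, a two-sided inverse \<open>S\<close> of \<open>T - z I\<close> is
  itself complex-linear.
\<close>

definition op_spectrum :: "('a::complex_hilbert_space \<Rightarrow>\<^sub>L 'a) \<Rightarrow> complex set" where
  "op_spectrum T = {z. \<not> (\<exists>S :: 'a \<Rightarrow>\<^sub>L 'a.
     \<forall>x. S (T x - z *\<^sub>C x) = x \<and> T (S x) - z *\<^sub>C S x = x)}"

text \<open>
  Continuous functional calculus of a self-adjoint operator \<open>A\<close>, whose spectrum is real,
  for a real function \<open>f\<close> continuous on that spectrum: \<open>f(A)\<close> is the operator-norm
  limit of \<open>q\<^sub>n(A)\<close> for any real polynomials \<open>q\<^sub>n\<close> converging to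
  \<open>f\<close> uniformly on the spectrum.
\<close>

definition op_fun :: "(real \<Rightarrow> real) \<Rightarrow> ('a::complex_hilbert_space \<Rightarrow>\<^sub>L 'a) \<Rightarrow> ('a \<Rightarrow>\<^sub>L 'a)" where
  "op_fun f A = (THE B. \<forall>q :: nat \<Rightarrow> real poly.
     uniform_limit {t. complex_of_real t \<in> op_spectrum A} (\<lambda>n. poly (q n)) f sequentially
       \<longrightarrow> (\<lambda>n. op_poly (q n) A) \<longlonglongrightarrow> B)"

text \<open>Only meant for positive \<open>A\<close> and \<open>p > 0\<close>, where \<open>0 powr p = 0\<close>
  makes the function continuous on the spectrum.\<close>

definition op_powr :: "('a::complex_hilbert_space \<Rightarrow>\<^sub>L 'a) \<Rightarrow> real \<Rightarrow> ('a \<Rightarrow>\<^sub>L 'a)" where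
  "op_powr A p = op_fun (\<lambda>t. t powr p) A"

definition op_abs :: "('a::complex_hilbert_space \<Rightarrow>\<^sub>L 'a) \<Rightarrow> ('a \<Rightarrow>\<^sub>L 'a)" where
  "op_abs T = op_powr (adj T o\<^sub>L T) (1 / 2)"

definition absolute_paranormal ::
    "real \<Rightarrow> real \<Rightarrow> ('a::complex_hilbert_space \<Rightarrow>\<^sub>L 'a) \<Rightarrow> bool" where
  "absolute_paranormal p r T \<longleftrightarrow>
     (\<forall>x. norm x = 1 \<longrightarrow>
        norm (op_powr (op_abs T) p (op_powr (op_abs (adj T)) r x)) powr r
          \<ge> norm (op_powr (op_abs (adj T)) r x) powr (p + r))"

end

theory Submission
  imports Defs "HOL-Computational_Algebra.Fundamental_Theorem_Algebra"
begin

text \<open>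
  Write \<open>S\<close> for the adjoint of \<open>T\<close> and \<open>N = T\<^sup>n\<close>. The proof cuts the
  space into thin spectral layers of \<open>N\<close>, on each of which \<open>T\<close> and \<open>S\<close> are almost
  multiples of isometries with the same constant, so that \<open>norm (T x)\<close> and \<open>norm (S x)\<close> agree
  up to an arbitrarily small error; equality of these norms for all \<open>x\<close> is normality
  (\<open>normal_of_norm_eq\<close>).

  The layers come from the subspaces \<open>E c\<close> of those \<open>x\<close> with
  \<open>norm (N\<^sup>k x) \<le> c\<^sup>k * norm x\<close> for all \<open>k\<close>
  (\<open>spectral_subspace\<close>). For normal \<open>N\<close> the sequence \<open>norm (N\<^sup>k x)\<close> is
  log-convex, so membership only depends on the growth rate. Since \<open>T\<close> commutes with \<open>N\<close>,
  and \<open>S\<close> with the adjoint of \<open>N\<close>, whose powers have the same norms on vectors,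
  \<open>E c\<close> is invariant under \<open>T\<close> and \<open>S\<close>; this takes the place of Fuglede's
  theorem. On the orthogonal complement of \<open>E c\<close> one has \<open>c * norm y \<le> norm (N y)\<close>
  (\<open>spectral_subspace_orthogonal_norm_ge\<close>).

  Paranormality enters through the bound \<open>norm (T x) \<le> t * norm x\<close> on \<open>E (t\<^sup>n)\<close>
  (\<open>paranormal_norm_le_of_power\<close>): on a closed subspace reducing \<open>T\<close> the norm of
  \<open>T\<^sup>n\<close> is the \<open>n\<close>-th power of the norm \<open>\<tau>\<close> of \<open>T\<close>. Indeed, if unit
  vectors \<open>x\<^sub>k\<close> satisfy \<open>norm (S x\<^sub>k) \<rightarrow> \<tau>\<close>, then \<open>|T\<^sup>*|\<^sup>r\<close> acts on
  them asymptotically as the number \<open>\<tau> powr r\<close>; the inequality then forces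
  \<open>norm (|T|\<^sup>p x\<^sub>k) \<rightarrow> \<tau> powr p\<close>, hence \<open>S (T x\<^sub>k) - \<tau>\<^sup>2 x\<^sub>k \<rightarrow> 0\<close>,
  so the normalised \<open>T x\<^sub>k\<close> are again such a sequence, and one iterates. For \<open>x\<close> in
  \<open>E (t\<^sup>n)\<close> and orthogonal to \<open>E (s\<^sup>n)\<close> this gives
  \<open>s\<^sup>n * norm x \<le> norm (N x) \<le> t ^ (n - 1) * norm (T x)\<close>, and likewise for \<open>S\<close>,
  so both norms lie between \<open>(t - n (t - s)) * norm x\<close> and \<open>t * norm x\<close>. Summing the
  squares over orthogonal layers of width \<open>e\<close> leaves an error of order \<open>e\<close>.

  The functional calculus rests on one positivity statement, \<open>op_poly_nonneg_on\<close>, valid on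
  every invariant subspace: it yields the norm estimate behind the convergence of \<open>q\<^sub>n(A)\<close> as
  well as all operator inequalities needed on \<open>E c\<close>.
\<close>

section \<open>Polynomials of an operator\<close>

lemma op_poly_upto:
  assumes "degree q \<le> m"
  shows "op_poly q A = (\<Sum>i\<le>m. coeff q i *\<^sub>R op_power A i)"
  unfolding op_poly_def
  by (rule sum.mono_neutral_left) (use assms in \<open>auto simp: coeff_eq_0\<close>)

lemma op_poly_add: "op_poly (p + q) A = op_poly p A + op_poly q A"
proof -
  define m where "m = max (degree p) (degree q)"
  have "degree (p + q) \<le> m" "degree p \<le> m" "degree q \<le> m"
    by (auto simp: m_def degree_add_le_max)
  then show ?thesis
    by (simp add: op_poly_upto[of _ m] sum.distrib scaleR_add_left)
qed

lemma op_poly_smult: "op_poly (smult c q) A = c *\<^sub>R op_poly q A"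
  by (simp add: op_poly_upto[of "smult c q" "degree q"] op_poly_upto[of q "degree q"] scaleR_sum_right)

lemma op_poly_0 [simp]: "op_poly 0 A = 0"
  by (simp add: op_poly_def)

lemma op_poly_diff: "op_poly (p - q) A = op_poly p A - op_poly q A"
  using op_poly_add[of "p - q" q A] by simp

lemma op_poly_pCons: "op_poly (pCons a q) A = a *\<^sub>R id_blinfun + (A o\<^sub>L op_poly q A)"
proof -
  have "op_poly (pCons a q) A = (\<Sum>i\<le>Suc (degree q). coeff (pCons a q) i *\<^sub>R op_power A i)"
    by (rule op_poly_upto) (simp add: degree_pCons_le)
  also have "\<dots> = a *\<^sub>R id_blinfun + (\<Sum>i\<le>degree q. coeff q i *\<^sub>R (A o\<^sub>L op_power A i))"
    by (simp add: sum.atMost_Suc_shift del: sum.atMost_Suc)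
  also have "(\<Sum>i\<le>degree q. coeff q i *\<^sub>R (A o\<^sub>L op_power A i)) = A o\<^sub>L op_poly q A"
    by (intro blinfun_eqI) (simp add: op_poly_def blinfun.sum_left blinfun.sum_right
          blinfun.scaleR_left blinfun.scaleR_right)
  finally show ?thesis .
qed

lemma op_poly_mult: "op_poly (p * q) A = op_poly p A o\<^sub>L op_poly q A"
proof (induction p)
  case (pCons a p)
  show ?case
    by (intro blinfun_eqI)
      (simp add: mult_pCons_left op_poly_add op_poly_smult op_poly_pCons pCons.IH
        blinfun.add_left blinfun.scaleR_left)
qed simp

lemma op_poly_linear: "op_poly [:- c, 1:] A x = A x - c *\<^sub>R x"
  by (simp add: op_poly_pCons blinfun.add_left blinfun.diff_left blinfun.scaleR_left blinfun.add_right blinfun.scaleR_right)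

lemma op_poly_const: "op_poly [:c:] A x = c *\<^sub>R x"
  by (simp add: op_poly_pCons blinfun.add_left blinfun.scaleR_left blinfun.add_right blinfun.scaleR_right)

lemma op_poly_invariant:
  fixes A :: "'a::real_normed_vector \<Rightarrow>\<^sub>L 'a"
  assumes "subspace M" "\<And>x. x \<in> M \<Longrightarrow> A x \<in> M" "x \<in> M"
  shows "op_poly q A x \<in> M"
proof (induction q)
  case 0
  then show ?case using assms(1) by (simp add: subspace_0)
next
  case (pCons a q)
  then show ?case using assms
    by (simp add: op_poly_pCons blinfun.add_left blinfun.scaleR_left subspace_add subspace_mul)
qed

definition symmetric_op :: "('a::real_inner \<Rightarrow>\<^sub>L 'a) \<Rightarrow> bool" where
  "symmetric_op A \<longleftrightarrow> (\<forall>x y. inner (A x) y = inner x (A y))"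

lemma op_poly_symmetric:
  assumes "symmetric_op A"
  shows "symmetric_op (op_poly q A)"
proof (induction q)
  case 0
  then show ?case by (simp add: symmetric_op_def)
next
  case (pCons a q)
  have "A (op_poly q A x) = op_poly q A (A x)" for x
    using arg_cong[of _ _ "\<lambda>B. blinfun_apply B x", OF op_poly_mult[of "[:0, 1:]" q A]]
      arg_cong[of _ _ "\<lambda>B. blinfun_apply B x", OF op_poly_mult[of q "[:0, 1:]" A]]
    by (simp add: mult.commute op_poly_pCons)
  then show ?case using pCons assms
    by (simp add: symmetric_op_def op_poly_pCons blinfun.add_left blinfun.scaleR_left inner_add_left
       inner_add_right)
qed

section \<open>Positivity of polynomials of a symmetric operator on an invariant subspace\<close>

definition bounded_below_on :: "'a::real_normed_vector set \<Rightarrow> ('a \<Rightarrow>\<^sub>L 'a) \<Rightarrow> bool" where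
  "bounded_below_on M A \<longleftrightarrow> (\<exists>d>0. \<forall>x\<in>M. d * norm x \<le> norm (A x))"

lemma bounded_below_on_compose:
  fixes A B :: "'a::real_normed_vector \<Rightarrow>\<^sub>L 'a"
  assumes "bounded_below_on M A" "bounded_below_on M B" "\<And>x. x \<in> M \<Longrightarrow> B x \<in> M"
  shows "bounded_below_on M (A o\<^sub>L B)"
proof -
  from assms obtain d e where d: "d > 0" "\<forall>x\<in>M. d * norm x \<le> norm (A x)"
    and e: "e > 0" "\<forall>x\<in>M. e * norm x \<le> norm (B x)"
    unfolding bounded_below_on_def by blast
  have "d * e * norm x \<le> norm (A (B x))" if "x \<in> M" for x
  proof -
    have "d * (e * norm x) \<le> d * norm (B x)" using d(1) e(2) that by simp
    also have "\<dots> \<le> norm (A (B x))" using d(2) assms(3)[OF that] by blast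
    finally show ?thesis by (simp add: mult.assoc)
  qed
  then show ?thesis unfolding bounded_below_on_def
    by (intro exI[of _ "d * e"]) (use d e in auto)
qed

lemma bounded_below_on_of_form:
  fixes B :: "'a::real_inner \<Rightarrow>\<^sub>L 'a"
  assumes "d > 0" "\<And>x. x \<in> M \<Longrightarrow> d * (norm x)\<^sup>2 \<le> inner (B x) x"
  shows "bounded_below_on M B"
proof -
  have "d * norm x \<le> norm (B x)" if "x \<in> M" for x
  proof (cases "x = 0")
    case False
    have "d * norm x * norm x \<le> norm (B x) * norm x"
      using assms(2)[OF that] norm_cauchy_schwarz[of "B x" x] by (simp add: power2_eq_square mult.assoc)
    then show ?thesis using False by simp
  qed simp
  then show ?thesis using assms(1) unfolding bounded_below_on_def by blast
qed

lemma map_poly_of_real_add: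
  "map_poly complex_of_real (p + q) = map_poly complex_of_real p + map_poly complex_of_real q"
  by (intro poly_eqI) (simp add: coeff_map_poly)

lemma map_poly_of_real_mult:
  "map_poly complex_of_real (p * q) = map_poly complex_of_real p * map_poly complex_of_real q"
  by (intro poly_eqI) (simp add: coeff_map_poly coeff_mult)

lemma poly_map_poly_of_real:
  "poly (map_poly complex_of_real q) (complex_of_real x) = complex_of_real (poly q x)"
  by (induction q) (simp_all add: map_poly_pCons)

text \<open>
  Factor \<open>q\<close>: real linear factors are bounded below by hypothesis, and a quadratic factor
  without real roots is bounded below at every symmetric operator. Bounds below compose on
  the invariant subspace.
\<close>

lemma op_poly_bounded_below:
  fixes A :: "'a::real_inner \<Rightarrow>\<^sub>L 'a"
  assumes M: "subspace M" "\<And>x. x \<in> M \<Longrightarrow> A x \<in> M" and sym: "symmetric_op A"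
    and "q \<noteq> 0"
    and "\<And>c. poly q c = 0 \<Longrightarrow> bounded_below_on M (A - c *\<^sub>R id_blinfun)"
  shows "bounded_below_on M (op_poly q A)"
  using assms(4,5)
proof (induction "degree q" arbitrary: q rule: less_induct)
  case less
  note inv = op_poly_invariant[OF M]
  have step: "bounded_below_on M (op_poly q A)"
    if q: "q = u * v" and u: "bounded_below_on M (op_poly u A)" and deg: "degree u > 0" for u v
  proof -
    have "u \<noteq> 0" "v \<noteq> 0" using q less.prems(1) by auto
    then have "degree v < degree q" using deg q by (simp add: degree_mult_eq)
    moreover have "bounded_below_on M (A - c *\<^sub>R id_blinfun)" if "poly v c = 0" for c
      by (rule less.prems(2)) (simp add: q that)
    ultimately have "bounded_below_on M (op_poly v A)"
      using less.hyps \<open>v \<noteq> 0\<close> by blast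
    then show ?thesis unfolding q op_poly_mult
      using u inv by (intro bounded_below_on_compose) auto
  qed
  consider "degree q = 0" | c where "poly q c = 0" | "degree q > 0" "\<And>c. poly q c \<noteq> 0" by blast
  then show ?case
  proof cases
    case 1
    then obtain c where c: "q = [:c:]" by (metis degree_eq_zeroE)
    with less.prems have "c \<noteq> 0" by auto
    then show ?thesis unfolding bounded_below_on_def c
      by (intro exI[of _ "\<bar>c\<bar>"]) (simp add: op_poly_const)
  next
    case (2 c)
    then obtain v where v: "q = [:- c, 1:] * v" by (metis poly_eq_0_iff_dvd dvd_def)
    have "op_poly [:- c, 1:] A = A - c *\<^sub>R id_blinfun"
      by (intro blinfun_eqI) (simp add: op_poly_linear blinfun.diff_left blinfun.scaleR_left)
    then have "bounded_below_on M (op_poly [:- c, 1:] A)" using less.prems(2) 2 by simp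
    then show ?thesis using step[OF v] by simp
  next
    case 3
    \<comment> \<open>A non-real root \<open>z\<close> splits off the quadratic with roots \<open>z\<close> and its conjugate,
      whose value at \<open>A\<close> is bounded below by the square of the imaginary part.\<close>
    define Q :: "complex poly" where "Q = map_poly complex_of_real q"
    have "\<not> constant (poly Q)"
      unfolding constant_degree using 3 by (simp add: Q_def degree_map_poly)
    then obtain z where z: "poly Q z = 0" using fundamental_theorem_of_algebra by blast
    define a where "a = Re z"
    define b where "b = Im z"
    have za: "z = Complex a b" by (simp add: a_def b_def)
    have b: "b \<noteq> 0"
    proof
      assume "b = 0"
      then have "z = complex_of_real a" by (simp add: za complex_of_real_def)
      then have "poly Q z = complex_of_real (poly q a)"
        by (simp add: Q_def poly_map_poly_of_real)
      then show False using z 3(2) by simp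
    qed
    define u where "u = [:a\<^sup>2 + b\<^sup>2, - 2 * a, 1:]"
    have degu: "degree u = 2" by (simp add: u_def)
    have PQ: "poly (map_poly complex_of_real w) z = 0" if "u dvd w" for w
    proof -
      obtain v where "w = u * v" using \<open>u dvd w\<close> by (elim dvdE)
      then have "map_poly complex_of_real w = map_poly complex_of_real u * map_poly complex_of_real v"
        by (simp only: map_poly_of_real_mult)
      moreover have "poly (map_poly complex_of_real u) z = 0"
        by (simp add: u_def map_poly_pCons za complex_eq_iff power2_eq_square algebra_simps)
      ultimately show ?thesis by simp
    qed
    have "q mod u = 0"
    proof -
      have "poly (map_poly complex_of_real (q mod u)) z = 0"
      proof -
        have "map_poly complex_of_real q
           = map_poly complex_of_real (u * (q div u)) + map_poly complex_of_real (q mod u)"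
          by (metis map_poly_of_real_add mult_div_mod_eq)
        then show ?thesis using PQ[of "u * (q div u)"] z by (simp add: Q_def)
      qed
      moreover have "degree (q mod u) < 2 \<or> q mod u = 0"
        using degree_mod_less[of u q] degu by (auto simp: u_def)
      then have "degree (q mod u) \<le> 1" by auto
      then obtain \<alpha> \<beta> where ab: "q mod u = [:\<alpha>, \<beta>:]"
        by (metis degree1_coeffs degree_eq_zeroE le_eq_less_or_eq less_one pCons_0_0)
      ultimately have "complex_of_real \<alpha> + z * complex_of_real \<beta> = 0"
        by (simp add: map_poly_pCons)
      then have "\<beta> = 0" "\<alpha> = 0" using b by (auto simp: za complex_eq_iff)
      then show ?thesis using ab by simp
    qed
    then obtain v where v: "q = u * v" by auto
    have "inner (op_poly u A x) x \<ge> b\<^sup>2 * (norm x)\<^sup>2" for x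
    proof -
      have "inner (op_poly u A x) x
          = (a\<^sup>2 + b\<^sup>2) * inner x x - 2 * a * inner (A x) x + inner (A x) (A x)"
        using sym by (simp add: u_def op_poly_pCons blinfun.add_left blinfun.diff_left blinfun.scaleR_left
            blinfun.add_right blinfun.diff_right blinfun.scaleR_right inner_add_left inner_diff_left
            inner_diff_right symmetric_op_def)
      also have "\<dots> = b\<^sup>2 * inner x x + inner (A x - a *\<^sub>R x) (A x - a *\<^sub>R x)"
        by (simp add: inner_diff_left inner_diff_right inner_commute algebra_simps power2_eq_square)
      finally show ?thesis by (simp add: power2_norm_eq_inner)
    qed
    then have "bounded_below_on M (op_poly u A)"
      using b by (intro bounded_below_on_of_form[of "b\<^sup>2"]) auto
    then show ?thesis using step[OF v] degu by simp
  qed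
qed

text \<open>
  The Cauchy-Schwarz argument for the semi-inner product of \<open>G\<close>, carried out by evaluating the
  form at \<open>x - t G x\<close> with \<open>t = 1 / norm G\<close>.
\<close>

lemma positive_norm_apply:
  fixes G :: "'a::real_inner \<Rightarrow>\<^sub>L 'a"
  assumes M: "\<And>x c. x \<in> M \<Longrightarrow> x - c *\<^sub>R G x \<in> M" and sym: "symmetric_op G"
    and pos: "\<And>x. x \<in> M \<Longrightarrow> inner (G x) x \<ge> 0" and x: "x \<in> M"
  shows "(norm (G x))\<^sup>2 \<le> norm G * inner (G x) x"
proof (cases "norm G = 0")
  case True
  then show ?thesis by simp
next
  case False
  define t where "t = 1 / norm G"
  have GG: "inner (G (G x)) x = (norm (G x))\<^sup>2" "inner x (G (G x)) = (norm (G x))\<^sup>2"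
    using sym by (simp_all add: symmetric_op_def power2_norm_eq_inner flip: dot_square_norm)
  have "0 \<le> inner (G (x - t *\<^sub>R G x)) (x - t *\<^sub>R G x)" using pos M x by blast
  also have "\<dots> = inner (G x) x - 2 * t * (norm (G x))\<^sup>2 + t\<^sup>2 * inner (G (G x)) (G x)"
    using GG by (simp add: blinfun.diff_right blinfun.scaleR_right inner_diff_left inner_diff_right
        dot_square_norm algebra_simps power2_eq_square)
  also have "\<dots> \<le> inner (G x) x - 2 * t * (norm (G x))\<^sup>2 + t\<^sup>2 * (norm G * (norm (G x))\<^sup>2)"
  proof -
    have "inner (G (G x)) (G x) \<le> norm (G (G x)) * norm (G x)" by (rule norm_cauchy_schwarz)
    also have "\<dots> \<le> norm G * norm (G x) * norm (G x)"
      by (intro mult_right_mono norm_blinfun) auto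
    finally have "inner (G (G x)) (G x) \<le> norm G * (norm (G x))\<^sup>2"
      by (simp add: power2_eq_square mult.assoc)
    then have "t\<^sup>2 * inner (G (G x)) (G x) \<le> t\<^sup>2 * (norm G * (norm (G x))\<^sup>2)"
      by (rule mult_left_mono) simp
    then show ?thesis by simp
  qed
  also have "\<dots> = inner (G x) x - (norm (G x))\<^sup>2 / norm G"
    using False by (simp add: t_def power2_eq_square field_simps)
  finally show ?thesis using False by (simp add: field_simps)
qed

text \<open>
  The bottom \<open>m\<close> of the numerical range on \<open>M\<close> is an approximate eigenvalue there: along a
  minimising sequence the form of the positive operator \<open>G - m\<close> tends to zero, hence so does
  the operator itself.
\<close>

lemma form_Inf_not_bounded_below:
  fixes G :: "'a::real_inner \<Rightarrow>\<^sub>L 'a"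
  assumes M: "subspace M" "\<And>x. x \<in> M \<Longrightarrow> G x \<in> M" and sym: "symmetric_op G"
    and x0: "x0 \<in> M" "x0 \<noteq> 0"
  obtains m where "\<not> bounded_below_on M (G - m *\<^sub>R id_blinfun)"
    and "\<And>x. x \<in> M \<Longrightarrow> m * (norm x)\<^sup>2 \<le> inner (G x) x"
proof -
  define V where "V = {inner (G x) x | x. x \<in> M \<and> norm x = 1}"
  define m where "m = Inf V"
  have bdd: "bdd_below V"
  proof -
    have "- norm G \<le> inner (G x) x" if "norm x = 1" for x
    proof -
      have "\<bar>inner (G x) x\<bar> \<le> norm (G x) * norm x" by (rule Cauchy_Schwarz_ineq2)
      also have "\<dots> \<le> norm G" using norm_blinfun[of G x] that by simp
      finally show ?thesis by linarith
    qed
    then show ?thesis unfolding V_def by (intro bdd_belowI[of _ "- norm G"]) auto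
  qed
  have "(1 / norm x0) *\<^sub>R x0 \<in> M" "norm ((1 / norm x0) *\<^sub>R x0) = 1"
    using x0 M(1) by (auto intro: subspace_mul)
  then have ne: "V \<noteq> {}" unfolding V_def by blast
  have low: "m * (norm x)\<^sup>2 \<le> inner (G x) x" if "x \<in> M" for x
  proof (cases "x = 0")
    case False
    define y where "y = (1 / norm x) *\<^sub>R x"
    have y: "y \<in> M" "norm y = 1" using False that M(1) by (auto simp: y_def intro: subspace_mul)
    then have "m \<le> inner (G y) y" unfolding m_def
      by (intro cInf_lower bdd) (auto simp: V_def)
    also have "inner (G y) y = inner (G x) x / (norm x)\<^sup>2"
      by (simp add: y_def blinfun.scaleR_right power2_eq_square)
    finally show ?thesis using False by (simp add: field_simps)
  qed simp
  define H where "H = G - m *\<^sub>R id_blinfun"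
  have Hx: "H x = G x - m *\<^sub>R x" for x
    by (simp add: H_def blinfun.diff_left blinfun.scaleR_left)
  have Hsym: "symmetric_op H" using sym
    by (simp add: symmetric_op_def Hx inner_diff_left inner_diff_right)
  have Hpos: "inner (H x) x \<ge> 0" if "x \<in> M" for x
    using low[OF that] by (simp add: Hx inner_diff_left power2_norm_eq_inner)
  have HM: "x - c *\<^sub>R H x \<in> M" if "x \<in> M" for x c
    using that M by (simp add: Hx subspace_diff subspace_mul)
  have "\<not> bounded_below_on M H"
  proof
    assume "bounded_below_on M H"
    then obtain d where d: "d > 0" "\<And>x. x \<in> M \<Longrightarrow> d * norm x \<le> norm (H x)"
      unfolding bounded_below_on_def by blast
    define K where "K = norm H + 1"
    have K: "K > 0" using norm_ge_zero[of H] by (simp add: K_def add_nonneg_pos)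
    have "m + d\<^sup>2 / K \<le> v" if "v \<in> V" for v
    proof -
      obtain x where x: "x \<in> M" "norm x = 1" "v = inner (G x) x" using \<open>v \<in> V\<close> V_def by auto
      have "d\<^sup>2 \<le> (norm (H x))\<^sup>2" using d(1) d(2)[of x] x by (intro power_mono) simp_all
      also have "\<dots> \<le> norm H * inner (H x) x"
        using positive_norm_apply[OF HM Hsym Hpos x(1)] by blast
      also have "\<dots> \<le> K * inner (H x) x" using Hpos[OF x(1)] by (simp add: K_def mult_right_mono)
      finally have "d\<^sup>2 / K \<le> inner (H x) x" using K by (simp add: field_simps)
      also have "\<dots> = v - m" using x by (simp add: Hx inner_diff_left dot_square_norm)
      finally show ?thesis by simp
    qed
    then have "m + d\<^sup>2 / K \<le> m" unfolding m_def using cInf_greatest[OF ne] by blast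
    then show False using d K by (simp add: field_simps)
  qed
  then show thesis using that low unfolding H_def by blast
qed

text \<open>
  If the infimum \<open>m\<close> of the form of \<open>q(A)\<close> on \<open>M\<close> is an approximate eigenvalue of
  \<open>q(A)\<close>, then \<open>q - m\<close> vanishes at an approximate eigenvalue of \<open>A\<close>. So this is the
  spectral mapping theorem in the form needed, localised to an invariant subspace.
\<close>

lemma op_poly_nonneg_on:
  fixes A :: "'a::real_inner \<Rightarrow>\<^sub>L 'a"
  assumes M: "subspace M" "\<And>x. x \<in> M \<Longrightarrow> A x \<in> M" and sym: "symmetric_op A"
    and nonneg: "\<And>c. \<not> bounded_below_on M (A - c *\<^sub>R id_blinfun) \<Longrightarrow> poly q c \<ge> 0"
    and x: "x \<in> M"
  shows "inner (op_poly q A x) x \<ge> 0"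
proof (cases "x = 0")
  case False
  obtain m where m: "\<not> bounded_below_on M (op_poly q A - m *\<^sub>R id_blinfun)"
    "\<And>x. x \<in> M \<Longrightarrow> m * (norm x)\<^sup>2 \<le> inner (op_poly q A x) x"
    using form_Inf_not_bounded_below[OF M(1) op_poly_invariant[OF M] op_poly_symmetric[OF sym] x False]
    by blast
  have eq: "op_poly (q - [:m:]) A = op_poly q A - m *\<^sub>R id_blinfun"
    by (simp add: op_poly_diff op_poly_pCons blinfun_eqI blinfun.zero_right blinfun.diff_left)
  have "m \<ge> 0"
  proof (cases "q - [:m:] = 0")
    \<comment> \<open>For constant \<open>q\<close> some approximate eigenvalue of \<open>A\<close> on \<open>M\<close> is still needed to
      learn the sign of the constant.\<close>
    case True
    obtain l where "\<not> bounded_below_on M (A - l *\<^sub>R id_blinfun)"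
      using form_Inf_not_bounded_below[OF M sym x False] by blast
    then show ?thesis using nonneg[of l] True by simp
  next
    case F: False
    obtain c where "poly (q - [:m:]) c = 0" "\<not> bounded_below_on M (A - c *\<^sub>R id_blinfun)"
      using op_poly_bounded_below[OF M sym F] m(1) eq by auto
    then show ?thesis using nonneg[of c] by simp
  qed
  then show ?thesis using m(2)[OF x]
    by (meson order_trans zero_le_mult_iff zero_le_power2)
qed simp

section \<open>The continuous functional calculus\<close>

instance complex_hilbert_space \<subseteq> banach ..

text \<open>
  For small \<open>c > 0\<close> the map \<open>x \<mapsto> x - c (C x - y)\<close> is a contraction, and its fixed point
  solves \<open>C x = y\<close>.
\<close>

lemma coercive_inverse:
  fixes C :: "'a::{real_inner,complete_space} \<Rightarrow>\<^sub>L 'a"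
  assumes "d > 0" and co: "\<And>x. d * (norm x)\<^sup>2 \<le> inner (C x) x"
  obtains S :: "'a \<Rightarrow>\<^sub>L 'a" where "\<And>x. S (C x) = x" "\<And>x. C (S x) = x"
proof -
  have below: "d * norm x \<le> norm (C x)" for x
  proof (cases "x = 0")
    case False
    have "d * norm x * norm x \<le> norm (C x) * norm x"
      using co[of x] norm_cauchy_schwarz[of "C x" x] by (simp add: power2_eq_square mult.assoc)
    then show ?thesis using False by simp
  qed simp
  have inj: "x = y" if "C x = C y" for x y
    using below[of "x - y"] that \<open>d > 0\<close> by (simp add: blinfun.diff_right mult_le_0_iff)
  have surj: "\<exists>x. C x = y" for y
  proof -
    define K where "K = norm C + d"
    have K: "K > 0" "norm C \<le> K" "d \<le> K"
      using \<open>d > 0\<close> norm_ge_zero[of C] by (auto simp: K_def add_nonneg_pos)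
    \<comment> \<open>The step \<open>c = d / K\<^sup>2\<close> minimises the contraction constant \<open>1 - 2 c d + c\<^sup>2 K\<^sup>2\<close>.\<close>
    define c where "c = d / K\<^sup>2"
    define L where "L = sqrt (1 - d\<^sup>2 / K\<^sup>2)"
    have dK: "0 < d\<^sup>2 / K\<^sup>2" "d\<^sup>2 / K\<^sup>2 \<le> 1"
      using K \<open>d > 0\<close> by (auto simp: power_mono)
    have L: "0 \<le> L" "L < 1" "L\<^sup>2 = 1 - d\<^sup>2 / K\<^sup>2" using dK by (auto simp: L_def)
    define F where "F x = x - c *\<^sub>R (C x - y)" for x
    have "dist (F u) (F v) \<le> L * dist u v" for u v
    proof -
      define z where "z = u - v"
      have "c > 0" using \<open>d > 0\<close> K by (simp add: c_def)
      have "F u - F v = z - c *\<^sub>R C z"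
        by (simp add: F_def z_def blinfun.diff_right algebra_simps)
      then have "(norm (F u - F v))\<^sup>2 = (norm (z - c *\<^sub>R C z))\<^sup>2" by simp
      also have "\<dots> = (norm z)\<^sup>2 - 2 * c * inner (C z) z + c\<^sup>2 * (norm (C z))\<^sup>2"
        unfolding power2_norm_eq_inner
        by (simp add: inner_diff_left inner_diff_right inner_commute power2_eq_square)
      also have "\<dots> \<le> (norm z)\<^sup>2 - 2 * c * (d * (norm z)\<^sup>2) + c\<^sup>2 * (K * norm z)\<^sup>2"
      proof -
        have "norm (C z) \<le> K * norm z"
          using norm_blinfun[of C z] K(2) by (meson mult_right_mono norm_ge_zero order_trans)
        then have "(norm (C z))\<^sup>2 \<le> (K * norm z)\<^sup>2" by (intro power_mono) auto
        then have "c\<^sup>2 * (norm (C z))\<^sup>2 \<le> c\<^sup>2 * (K * norm z)\<^sup>2" by (intro mult_left_mono) auto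
        moreover have "c * (d * (norm z)\<^sup>2) \<le> c * inner (C z) z"
          using co[of z] \<open>c > 0\<close> by simp
        ultimately show ?thesis by (simp add: mult.assoc)
      qed
      also have "\<dots> = (L * norm z)\<^sup>2"
        using K unfolding power_mult_distrib L(3) by (simp add: c_def field_simps power2_eq_square)
      finally have "norm (F u - F v) \<le> L * norm z"
        by (rule power2_le_imp_le) (use L in auto)
      then show ?thesis by (simp add: dist_norm z_def)
    qed
    then have "\<exists>!x. F x = x"
      using L by (intro banach_fix_type) auto
    then obtain x where "F x = x" by blast
    moreover have "c \<noteq> 0" using \<open>d > 0\<close> K by (simp add: c_def)
    ultimately have "C x = y" by (simp add: F_def)
    then show ?thesis by blast
  qed
  obtain s where s: "\<And>y. C (s y) = y" using surj by metis
  have "bounded_linear s"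
  proof (rule bounded_linear_intro[of _ "1 / d"])
    show "s (x + y) = s x + s y" for x y by (rule inj) (simp add: s blinfun.add_right)
    show "s (r *\<^sub>R x) = r *\<^sub>R s x" for r x by (rule inj) (simp add: s blinfun.scaleR_right)
    show "norm (s x) \<le> norm x * (1 / d)" for x
      using below[of "s x"] \<open>d > 0\<close> by (simp add: s field_simps)
  qed
  then have "Blinfun s (C x) = x" "C (Blinfun s x) = x" for x
    using inj s by (auto simp: bounded_linear_Blinfun_apply)
  then show thesis using that by blast
qed

definition positive_op :: "('a::real_inner \<Rightarrow>\<^sub>L 'a) \<Rightarrow> bool" where
  "positive_op A \<longleftrightarrow> symmetric_op A \<and> (\<forall>x. 0 \<le> inner (A x) x)"

text \<open>
  Outside this interval \<open>A - t\<close> or its negative is coercive. It is what makes the functions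
  to be applied, which are only continuous on the half-line, approximable on the spectrum.
\<close>

lemma positive_op_spectrum:
  fixes A :: "'a::complex_hilbert_space \<Rightarrow>\<^sub>L 'a"
  assumes A: "positive_op A" and t: "complex_of_real t \<in> op_spectrum A"
  shows "t \<in> {0..norm A}"
proof (rule ccontr)
  assume "t \<notin> {0..norm A}"
  then consider "t < 0" | "t > norm A" by fastforce
  then have "\<exists>S :: 'a \<Rightarrow>\<^sub>L 'a. \<forall>x. S (A x - t *\<^sub>R x) = x \<and> A (S x) - t *\<^sub>R S x = x"
  proof cases
    case 1
    have "- t * (norm x)\<^sup>2 \<le> inner ((A - t *\<^sub>R id_blinfun) x) x" for x
      using A by (simp add: positive_op_def blinfun.diff_left blinfun.scaleR_left inner_diff_left
          power2_norm_eq_inner)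
    moreover have "- t > 0" using 1 by simp
    ultimately obtain S :: "'a \<Rightarrow>\<^sub>L 'a" where "\<And>x. S ((A - t *\<^sub>R id_blinfun) x) = x"
      "\<And>x. (A - t *\<^sub>R id_blinfun) (S x) = x"
      using coercive_inverse[of "- t" "A - t *\<^sub>R id_blinfun"] by blast
    then show ?thesis
      by (intro exI[of _ S]) (simp add: blinfun.diff_left blinfun.scaleR_left)
  next
    case 2
    have "(t - norm A) * (norm x)\<^sup>2 \<le> inner ((t *\<^sub>R id_blinfun - A) x) x" for x
    proof -
      have "inner (A x) x \<le> norm (A x) * norm x" by (rule norm_cauchy_schwarz)
      also have "\<dots> \<le> norm A * norm x * norm x" by (intro mult_right_mono norm_blinfun) auto
      finally show ?thesis
        by (simp add: blinfun.diff_left blinfun.scaleR_left inner_diff_left dot_square_norm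
            power2_eq_square algebra_simps)
    qed
    moreover have "t - norm A > 0" using 2 by simp
    ultimately obtain S :: "'a \<Rightarrow>\<^sub>L 'a" where S: "\<And>x. S ((t *\<^sub>R id_blinfun - A) x) = x"
      "\<And>x. (t *\<^sub>R id_blinfun - A) (S x) = x"
      using coercive_inverse[of "t - norm A" "t *\<^sub>R id_blinfun - A"] by blast
    have "(- S) (A x - t *\<^sub>R x) = x \<and> A ((- S) x) - t *\<^sub>R (- S) x = x" for x
      using S[of x]
      by (simp add: blinfun.minus_left blinfun.minus_right blinfun.diff_left blinfun.diff_right
          blinfun.scaleR_left)
    then show ?thesis by blast
  qed
  then show False using t unfolding op_spectrum_def mem_Collect_eq scaleC_of_real by blast
qed

lemma not_bounded_below_spectrum:
  fixes A :: "'a::complex_hilbert_space \<Rightarrow>\<^sub>L 'a"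
  assumes "\<not> bounded_below_on UNIV (A - c *\<^sub>R id_blinfun)"
  shows "complex_of_real c \<in> op_spectrum A"
proof (rule ccontr)
  assume "complex_of_real c \<notin> op_spectrum A"
  then obtain S :: "'a \<Rightarrow>\<^sub>L 'a" where S: "\<And>x. S (A x - c *\<^sub>R x) = x"
    by (auto simp: op_spectrum_def scaleC_of_real)
  define K where "K = norm S + 1"
  have K: "K > 0" using norm_ge_zero[of S] by (simp add: K_def add_nonneg_pos)
  have "norm x \<le> K * norm ((A - c *\<^sub>R id_blinfun) x)" for x
  proof -
    have "norm x \<le> norm S * norm (A x - c *\<^sub>R x)" using norm_blinfun[of S "A x - c *\<^sub>R x"] by (simp add: S)
    also have "\<dots> \<le> K * norm (A x - c *\<^sub>R x)" by (intro mult_right_mono) (auto simp: K_def)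
    finally show ?thesis by (simp add: blinfun.diff_left blinfun.scaleR_left)
  qed
  then have "bounded_below_on UNIV (A - c *\<^sub>R id_blinfun)"
    unfolding bounded_below_on_def using K by (intro exI[of _ "1 / K"]) (auto simp: field_simps)
  then show False using assms by blast
qed

text \<open>
  Positivity of \<open>c\<^sup>2 - q\<^sup>2\<close> at \<open>A\<close>.
\<close>

lemma op_poly_norm_le:
  fixes A :: "'a::complex_hilbert_space \<Rightarrow>\<^sub>L 'a"
  assumes sym: "symmetric_op A" and "c \<ge> 0"
    and le: "\<And>t. complex_of_real t \<in> op_spectrum A \<Longrightarrow> \<bar>poly q t\<bar> \<le> c"
  shows "norm (op_poly q A) \<le> c"
proof (rule norm_blinfun_bound[OF \<open>c \<ge> 0\<close>])
  fix x
  have "0 \<le> inner (op_poly ([:c\<^sup>2:] - q * q) A x) x"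
  proof (rule op_poly_nonneg_on[of UNIV])
    show "0 \<le> poly ([:c\<^sup>2:] - q * q) t" if "\<not> bounded_below_on UNIV (A - t *\<^sub>R id_blinfun)" for t
      using power_mono[OF le[OF not_bounded_below_spectrum[OF that]], of 2]
      by (simp add: power2_eq_square)
  qed (use sym in auto)
  also have "\<dots> = (c * norm x)\<^sup>2 - (norm (op_poly q A x))\<^sup>2"
    using op_poly_symmetric[OF sym, of q]
    by (simp add: op_poly_diff op_poly_mult blinfun.diff_left op_poly_const inner_diff_left
        symmetric_op_def dot_square_norm power_mult_distrib)
  finally have "(norm (op_poly q A x))\<^sup>2 \<le> (c * norm x)\<^sup>2" by simp
  then show "norm (op_poly q A x) \<le> c * norm x"
    by (rule power2_le_imp_le) (use \<open>c \<ge> 0\<close> in auto)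
qed

lemma continuous_uniform_limit_poly:
  fixes f :: "real \<Rightarrow> real"
  assumes "continuous_on {a..b} f"
  obtains q where "uniform_limit {a..b} (\<lambda>n. poly (q n)) f sequentially"
proof -
  have "\<exists>q. \<forall>x\<in>{a..b}. \<bar>poly q x - f x\<bar> < 1 / real (Suc n)" for n
  proof -
    obtain g where g: "real_polynomial_function g" "\<And>x. x \<in> {a..b} \<Longrightarrow> \<bar>f x - g x\<bar> < 1 / real (Suc n)"
      using Stone_Weierstrass_real_polynomial_function[of "{a..b}" f "1 / real (Suc n)"] assms by auto
    obtain c m where "g = (\<lambda>x. \<Sum>i\<le>m. c i * x ^ i)"
      using g(1) unfolding real_polynomial_function_iff_sum by blast
    then have "g = poly (\<Sum>i\<le>m. monom (c i) i)"
      by (auto simp: poly_sum poly_monom)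
    then show ?thesis using g(2) by (metis abs_minus_commute)
  qed
  then obtain q where q: "\<And>n x. x \<in> {a..b} \<Longrightarrow> \<bar>poly (q n) x - f x\<bar> < 1 / real (Suc n)" by metis
  have "uniform_limit {a..b} (\<lambda>n. poly (q n)) f sequentially"
    unfolding uniform_limit_iff
  proof (intro allI impI)
    fix e :: real assume "e > 0"
    then have "eventually (\<lambda>n. 1 / real (Suc n) < e) sequentially"
      using order_tendstoD(2)[OF LIMSEQ_Suc[OF lim_1_over_n]] by simp
    then show "\<forall>\<^sub>F n in sequentially. \<forall>x\<in>{a..b}. dist (poly (q n) x) (f x) < e"
    proof eventually_elim
      case (elim n)
      then show ?case using order_less_trans[OF q[of _ n]] by (simp add: dist_real_def)
    qed
  qed
  then show thesis using that by blast
qed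

lemma op_poly_limits_agree:
  fixes A :: "'a::complex_hilbert_space \<Rightarrow>\<^sub>L 'a"
  assumes sym: "symmetric_op A" and "e > 0"
    and p: "uniform_limit {t. complex_of_real t \<in> op_spectrum A} (\<lambda>n. poly (p n)) f sequentially"
    and q: "uniform_limit {t. complex_of_real t \<in> op_spectrum A} (\<lambda>n. poly (q n)) f sequentially"
  shows "\<exists>N. \<forall>m\<ge>N. \<forall>n\<ge>N. norm (op_poly (p m) A - op_poly (q n) A) \<le> e"
proof -
  have "e / 2 > 0" using \<open>e > 0\<close> by simp
  then have "eventually (\<lambda>n. (\<forall>t. complex_of_real t \<in> op_spectrum A \<longrightarrow> dist (poly (p n) t) (f t) < e / 2)
     \<and> (\<forall>t. complex_of_real t \<in> op_spectrum A \<longrightarrow> dist (poly (q n) t) (f t) < e / 2)) sequentially"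
    using p q unfolding uniform_limit_iff mem_Collect_eq Ball_def by (intro eventually_conj) blast+
  then obtain N where N: "\<And>n t. n \<ge> N \<Longrightarrow> complex_of_real t \<in> op_spectrum A \<Longrightarrow> dist (poly (p n) t) (f t) < e / 2"
     "\<And>n t. n \<ge> N \<Longrightarrow> complex_of_real t \<in> op_spectrum A \<Longrightarrow> dist (poly (q n) t) (f t) < e / 2"
    unfolding eventually_sequentially by blast
  have "norm (op_poly (p m - q n) A) \<le> e" if "m \<ge> N" "n \<ge> N" for m n
  proof (rule op_poly_norm_le[OF sym])
    show "\<bar>poly (p m - q n) t\<bar> \<le> e" if "complex_of_real t \<in> op_spectrum A" for t
      using N(1)[OF \<open>m \<ge> N\<close> that] N(2)[OF \<open>n \<ge> N\<close> that] by (simp add: dist_real_def abs_if split: if_splits)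
  qed (use \<open>e > 0\<close> in simp)
  then show ?thesis by (auto simp: op_poly_diff)
qed

text \<open>
  Uniform approximation on \<open>{0..norm A}\<close> provides one convergent sequence; the norm estimate
  shows that all admissible sequences have the same limit, so the description in the
  definition of \<open>op_fun\<close> has exactly one solution.
\<close>

lemma op_poly_tendsto_op_fun_spectrum:
  fixes A :: "'a::complex_hilbert_space \<Rightarrow>\<^sub>L 'a"
  assumes A: "positive_op A" and f: "continuous_on {0..} f"
    and q: "uniform_limit {t. complex_of_real t \<in> op_spectrum A} (\<lambda>n. poly (q n)) f sequentially"
  shows "(\<lambda>n. op_poly (q n) A) \<longlonglongrightarrow> op_fun f A"
proof -
  have sym: "symmetric_op A" using A by (simp add: positive_op_def)
  let ?\<sigma> = "{t. complex_of_real t \<in> op_spectrum A}"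
  have "continuous_on {0..norm A} f" using f by (rule continuous_on_subset) auto
  then obtain g where "uniform_limit {0..norm A} (\<lambda>n. poly (g n)) f sequentially"
    using continuous_uniform_limit_poly by blast
  then have g: "uniform_limit ?\<sigma> (\<lambda>n. poly (g n)) f sequentially"
    by (rule uniform_limit_on_subset) (use positive_op_spectrum[OF A] in blast)
  have "Cauchy (\<lambda>n. op_poly (g n) A)"
    unfolding Cauchy_def
  proof (intro allI impI)
    fix e :: real assume "e > 0"
    show "\<exists>M. \<forall>m\<ge>M. \<forall>n\<ge>M. dist (op_poly (g m) A) (op_poly (g n) A) < e"
    proof -
      obtain N where N: "\<forall>m\<ge>N. \<forall>n\<ge>N. norm (op_poly (g m) A - op_poly (g n) A) \<le> e / 2"
        using op_poly_limits_agree[OF sym _ g g, of "e / 2"] \<open>e > 0\<close> by auto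
      have "dist (op_poly (g m) A) (op_poly (g n) A) < e" if "m \<ge> N" "n \<ge> N" for m n
        unfolding dist_norm using N[rule_format, OF that] \<open>e > 0\<close> by linarith
      then show ?thesis by blast
    qed
  qed
  then obtain B where B: "(\<lambda>n. op_poly (g n) A) \<longlonglongrightarrow> B"
    by (auto simp: Cauchy_convergent_iff convergent_def)
  have lim: "(\<lambda>n. op_poly (h n) A) \<longlonglongrightarrow> B" if h: "uniform_limit ?\<sigma> (\<lambda>n. poly (h n)) f sequentially" for h
  proof -
    have "(\<lambda>n. op_poly (h n) A - op_poly (g n) A) \<longlonglongrightarrow> 0"
    proof (rule LIMSEQ_I)
      fix e :: real assume "e > 0"
      obtain N where N: "\<forall>m\<ge>N. \<forall>n\<ge>N. norm (op_poly (h m) A - op_poly (g n) A) \<le> e / 2"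
        using op_poly_limits_agree[OF sym _ h g, of "e / 2"] \<open>e > 0\<close> by auto
      have "norm (op_poly (h n) A - op_poly (g n) A - 0) < e" if "n \<ge> N" for n
        using N[rule_format, OF that that] \<open>e > 0\<close> by simp
      then show "\<exists>N. \<forall>n\<ge>N. norm (op_poly (h n) A - op_poly (g n) A - 0) < e" by blast
    qed
    from tendsto_add[OF this B] show ?thesis by simp
  qed
  have "op_fun f A = B"
    unfolding op_fun_def
  proof (rule the_equality)
    show "\<forall>q. uniform_limit ?\<sigma> (\<lambda>n. poly (q n)) f sequentially \<longrightarrow> (\<lambda>n. op_poly (q n) A) \<longlonglongrightarrow> B"
      using lim by blast
    show "B' = B" if "\<forall>q. uniform_limit ?\<sigma> (\<lambda>n. poly (q n)) f sequentially \<longrightarrow> (\<lambda>n. op_poly (q n) A) \<longlonglongrightarrow> B'" for B'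
      using that g B LIMSEQ_unique by blast
  qed
  then show ?thesis using lim[OF q] by simp
qed

lemma op_poly_tendsto_op_fun:
  fixes A :: "'a::complex_hilbert_space \<Rightarrow>\<^sub>L 'a"
  assumes A: "positive_op A" and f: "continuous_on {0..} f" and "R \<ge> norm A"
    and q: "uniform_limit {0..R} (\<lambda>n. poly (q n)) f sequentially"
  shows "(\<lambda>n. op_poly (q n) A) \<longlonglongrightarrow> op_fun f A"
proof (rule op_poly_tendsto_op_fun_spectrum[OF A f])
  show "uniform_limit {t. complex_of_real t \<in> op_spectrum A} (\<lambda>n. poly (q n)) f sequentially"
    using q by (rule uniform_limit_on_subset) (use positive_op_spectrum[OF A] \<open>R \<ge> norm A\<close> in fastforce)
qed

lemma op_fun_approx:
  fixes A :: "'a::complex_hilbert_space \<Rightarrow>\<^sub>L 'a"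
  assumes A: "positive_op A" and f: "continuous_on {0..} f" and "R \<ge> norm A"
  obtains q where "uniform_limit {0..R} (\<lambda>n. poly (q n)) f sequentially"
    and "(\<lambda>n. op_poly (q n) A) \<longlonglongrightarrow> op_fun f A"
proof -
  have "continuous_on {0..R} f" using f by (rule continuous_on_subset) auto
  then show thesis using that continuous_uniform_limit_poly op_poly_tendsto_op_fun[OF assms] by metis
qed

lemma op_fun_poly:
  fixes A :: "'a::complex_hilbert_space \<Rightarrow>\<^sub>L 'a"
  assumes "positive_op A"
  shows "op_fun (poly q) A = op_poly q A"
proof -
  have "(\<lambda>n. op_poly q A) \<longlonglongrightarrow> op_fun (poly q) A"
    by (rule op_poly_tendsto_op_fun[OF assms _ order_refl])
      (auto intro: continuous_intros simp: uniform_limit_iff)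
  then show ?thesis using LIMSEQ_unique tendsto_const by blast
qed

lemma op_fun_diff:
  fixes A :: "'a::complex_hilbert_space \<Rightarrow>\<^sub>L 'a"
  assumes A: "positive_op A" and f: "continuous_on {0..} f" and g: "continuous_on {0..} g"
  shows "op_fun (\<lambda>t. f t - g t) A = op_fun f A - op_fun g A"
proof -
  obtain p where p: "uniform_limit {0..norm A} (\<lambda>n. poly (p n)) f sequentially"
    "(\<lambda>n. op_poly (p n) A) \<longlonglongrightarrow> op_fun f A" using op_fun_approx[OF A f order_refl] by blast
  obtain q where q: "uniform_limit {0..norm A} (\<lambda>n. poly (q n)) g sequentially"
    "(\<lambda>n. op_poly (q n) A) \<longlonglongrightarrow> op_fun g A" using op_fun_approx[OF A g order_refl] by blast
  have "(\<lambda>n. op_poly (p n - q n) A) \<longlonglongrightarrow> op_fun (\<lambda>t. f t - g t) A"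
    by (rule op_poly_tendsto_op_fun[OF A _ order_refl])
      (use uniform_limit_minus[OF p(1) q(1)] f g
        in \<open>auto intro: continuous_intros simp: poly_diff[abs_def]\<close>)
  then show ?thesis using tendsto_diff[OF p(2) q(2)] LIMSEQ_unique by (fastforce simp: op_poly_diff)
qed

lemma op_fun_mult:
  fixes A :: "'a::complex_hilbert_space \<Rightarrow>\<^sub>L 'a"
  assumes A: "positive_op A" and f: "continuous_on {0..} f" and g: "continuous_on {0..} g"
  shows "op_fun (\<lambda>t. f t * g t) A = op_fun f A o\<^sub>L op_fun g A"
proof -
  obtain p where p: "uniform_limit {0..norm A} (\<lambda>n. poly (p n)) f sequentially"
    "(\<lambda>n. op_poly (p n) A) \<longlonglongrightarrow> op_fun f A" using op_fun_approx[OF A f order_refl] by blast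
  obtain q where q: "uniform_limit {0..norm A} (\<lambda>n. poly (q n)) g sequentially"
    "(\<lambda>n. op_poly (q n) A) \<longlonglongrightarrow> op_fun g A" using op_fun_approx[OF A g order_refl] by blast
  have bdd: "bounded (h ` {0..norm A})" if "continuous_on {0..} h" for h :: "real \<Rightarrow> real"
    by (intro compact_imp_bounded compact_continuous_image continuous_on_subset[OF that]) auto
  have "(\<lambda>n. op_poly (p n * q n) A) \<longlonglongrightarrow> op_fun (\<lambda>t. f t * g t) A"
    by (rule op_poly_tendsto_op_fun[OF A _ order_refl])
      (use uniform_lim_mult[OF p(1) q(1) bdd[OF f] bdd[OF g]] f g
        in \<open>auto intro: continuous_intros simp: poly_mult[abs_def]\<close>)
  moreover have "(\<lambda>n. op_poly (p n * q n) A) \<longlonglongrightarrow> (op_fun f A o\<^sub>L op_fun g A)"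
    unfolding op_poly_mult
    by (rule bounded_bilinear.tendsto[OF bounded_bilinear_blinfun_compose p(2) q(2)])
  ultimately show ?thesis using LIMSEQ_unique by blast
qed

lemma op_fun_apply_tendsto:
  fixes A :: "'a::complex_hilbert_space \<Rightarrow>\<^sub>L 'a"
  assumes "(\<lambda>n. op_poly (q n) A) \<longlonglongrightarrow> B"
  shows "(\<lambda>n. op_poly (q n) A x) \<longlonglongrightarrow> B x"
  by (rule blinfun.tendsto[OF assms tendsto_const])

lemma op_fun_symmetric:
  fixes A :: "'a::complex_hilbert_space \<Rightarrow>\<^sub>L 'a"
  assumes A: "positive_op A" and f: "continuous_on {0..} f"
  shows "symmetric_op (op_fun f A)"
  unfolding symmetric_op_def
proof (intro allI)
  fix x y
  obtain q where "(\<lambda>n. op_poly (q n) A) \<longlonglongrightarrow> op_fun f A"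
    using op_fun_approx[OF A f order_refl] by blast
  note lim = op_fun_apply_tendsto[OF this]
  have "(\<lambda>n. inner (op_poly (q n) A x) y) \<longlonglongrightarrow> inner (op_fun f A x) y"
    by (intro tendsto_intros lim)
  moreover have "(\<lambda>n. inner x (op_poly (q n) A y)) \<longlonglongrightarrow> inner x (op_fun f A y)"
    by (intro tendsto_intros lim)
  moreover have "inner (op_poly (q n) A x) y = inner x (op_poly (q n) A y)" for n
    using op_poly_symmetric[of A] A by (auto simp: positive_op_def symmetric_op_def)
  ultimately show "inner (op_fun f A x) y = inner x (op_fun f A y)"
    using LIMSEQ_unique by simp
qed

lemma op_fun_invariant:
  fixes A :: "'a::complex_hilbert_space \<Rightarrow>\<^sub>L 'a"
  assumes A: "positive_op A" and f: "continuous_on {0..} f"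
    and M: "subspace M" "closed M" "\<And>x. x \<in> M \<Longrightarrow> A x \<in> M" and x: "x \<in> M"
  shows "op_fun f A x \<in> M"
proof -
  obtain q where "(\<lambda>n. op_poly (q n) A) \<longlonglongrightarrow> op_fun f A"
    using op_fun_approx[OF A f order_refl] by blast
  then have "(\<lambda>n. op_poly (q n) A x) \<longlonglongrightarrow> op_fun f A x" by (rule op_fun_apply_tendsto)
  moreover have "op_poly (q n) A x \<in> M" for n by (rule op_poly_invariant[OF M(1,3) x])
  ultimately show ?thesis by (rule closed_sequentially[OF M(2), rotated])
qed

text \<open>
  An approximating polynomial is at least \<open>-e\<close> on \<open>{0..\<tau>}\<close>, and on \<open>M\<close> only this part
  of the spectrum is visible, because the form of \<open>A\<close> is bounded by \<open>\<tau>\<close> there.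
\<close>

lemma op_fun_nonneg_on:
  fixes A :: "'a::complex_hilbert_space \<Rightarrow>\<^sub>L 'a"
  assumes A: "positive_op A" and f: "continuous_on {0..} f"
    and M: "subspace M" "\<And>x. x \<in> M \<Longrightarrow> A x \<in> M"
    and le: "\<And>x. x \<in> M \<Longrightarrow> inner (A x) x \<le> \<tau> * (norm x)\<^sup>2"
    and nonneg: "\<And>t. 0 \<le> t \<Longrightarrow> t \<le> \<tau> \<Longrightarrow> f t \<ge> 0"
    and x: "x \<in> M"
  shows "inner (op_fun f A x) x \<ge> 0"
proof -
  have sym: "symmetric_op A" using A by (simp add: positive_op_def)
  have spec: "c \<in> {0..\<tau>}" if c: "\<not> bounded_below_on M (A - c *\<^sub>R id_blinfun)" for c
  proof (rule ccontr)
    assume "c \<notin> {0..\<tau>}"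
    then consider "c < 0" | "c > \<tau>" by fastforce
    then show False
    proof cases
      case 1
      have "bounded_below_on M (A - c *\<^sub>R id_blinfun)"
        by (rule bounded_below_on_of_form[of "- c"])
          (use 1 A in \<open>auto simp: positive_op_def blinfun.diff_left blinfun.scaleR_left inner_diff_left
          power2_norm_eq_inner\<close>)
      then show False using c by blast
    next
      case 2
      have "bounded_below_on M (c *\<^sub>R id_blinfun - A)"
      proof (rule bounded_below_on_of_form[of "c - \<tau>"])
        show "(c - \<tau>) * (norm y)\<^sup>2 \<le> inner ((c *\<^sub>R id_blinfun - A) y) y" if "y \<in> M" for y
          using le[OF that] by (simp add: blinfun.diff_left blinfun.scaleR_left inner_diff_left
              dot_square_norm left_diff_distrib)
      qed (use 2 in simp)
      then have "bounded_below_on M (A - c *\<^sub>R id_blinfun)"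
        unfolding bounded_below_on_def by (simp add: blinfun.diff_left norm_minus_commute)
      then show False using c by blast
    qed
  qed
  define R where "R = max \<tau> (norm A)"
  obtain q where q: "uniform_limit {0..R} (\<lambda>n. poly (q n)) f sequentially"
    "(\<lambda>n. op_poly (q n) A) \<longlonglongrightarrow> op_fun f A" using op_fun_approx[OF A f, of R] by (auto simp: R_def)
  have "- (e * (norm x)\<^sup>2) \<le> inner (op_fun f A x) x" if "e > 0" for e
  proof (rule tendsto_lowerbound)
    show "(\<lambda>n. inner (op_poly (q n) A x) x) \<longlonglongrightarrow> inner (op_fun f A x) x"
      by (intro tendsto_intros op_fun_apply_tendsto q)
    have "\<forall>\<^sub>F n in sequentially. \<forall>t\<in>{0..R}. dist (poly (q n) t) (f t) < e"
      using q(1) \<open>e > 0\<close> unfolding uniform_limit_iff by blast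
    then show "\<forall>\<^sub>F n in sequentially. - (e * (norm x)\<^sup>2) \<le> inner (op_poly (q n) A x) x"
    proof eventually_elim
      case (elim n)
      have "0 \<le> inner (op_poly (q n + [:e:]) A x) x"
      proof (rule op_poly_nonneg_on[OF M sym _ x])
        fix c assume "\<not> bounded_below_on M (A - c *\<^sub>R id_blinfun)"
        then have c: "c \<in> {0..\<tau>}" by (rule spec)
        then have "dist (poly (q n) c) (f c) < e" using elim by (auto simp: R_def)
        then show "0 \<le> poly (q n + [:e:]) c" using nonneg[of c] c by (auto simp: dist_real_def)
      qed auto
      then show ?case
        by (simp add: op_poly_add blinfun.add_left op_poly_const inner_add_left dot_square_norm)
    qed
  qed simp
  then have "0 \<le> inner (op_fun f A x) x + e" if "e > 0" for e
  proof -
    have "(norm x)\<^sup>2 + 1 > 0" by (simp add: add_nonneg_pos)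
    then have "e / ((norm x)\<^sup>2 + 1) > 0" "e / ((norm x)\<^sup>2 + 1) * (norm x)\<^sup>2 \<le> e"
      using that by (auto simp: field_simps)
    then show ?thesis
      using \<open>\<And>e. e > 0 \<Longrightarrow> - (e * (norm x)\<^sup>2) \<le> inner (op_fun f A x) x\<close>[of "e / ((norm x)\<^sup>2 + 1)"] by linarith
  qed
  then show ?thesis by (rule field_le_epsilon)
qed

lemma op_fun_mono_on:
  fixes A :: "'a::complex_hilbert_space \<Rightarrow>\<^sub>L 'a"
  assumes A: "positive_op A" and f: "continuous_on {0..} f" and g: "continuous_on {0..} g"
    and M: "subspace M" "\<And>x. x \<in> M \<Longrightarrow> A x \<in> M"
    and le: "\<And>x. x \<in> M \<Longrightarrow> inner (A x) x \<le> \<tau> * (norm x)\<^sup>2"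
    and fg: "\<And>t. 0 \<le> t \<Longrightarrow> t \<le> \<tau> \<Longrightarrow> f t \<le> g t"
    and x: "x \<in> M"
  shows "inner (op_fun f A x) x \<le> inner (op_fun g A x) x"
proof -
  have "0 \<le> inner (op_fun (\<lambda>t. g t - f t) A x) x"
    by (rule op_fun_nonneg_on[OF A _ M le _ x]) (use f g fg in \<open>auto intro: continuous_intros\<close>)
  then show ?thesis by (simp add: op_fun_diff[OF A g f] blinfun.diff_left inner_diff_left)
qed

lemma op_fun_cong:
  fixes A :: "'a::complex_hilbert_space \<Rightarrow>\<^sub>L 'a"
  assumes A: "positive_op A" and f: "continuous_on {0..} f" and eq: "\<And>t. t \<ge> 0 \<Longrightarrow> f t = g t"
  shows "op_fun f A = op_fun g A"
proof -
  have g: "continuous_on {0..} g" using continuous_on_cong[of "{0..}" "{0..}" f g] f eq by simp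
  obtain q where q: "uniform_limit {0..norm A} (\<lambda>n. poly (q n)) f sequentially"
    "(\<lambda>n. op_poly (q n) A) \<longlonglongrightarrow> op_fun f A" using op_fun_approx[OF A f order_refl] by blast
  have "uniform_limit {0..norm A} (\<lambda>n. poly (q n)) g sequentially"
    using q(1) eq by (simp add: uniform_limit_iff)
  then show ?thesis using op_poly_tendsto_op_fun[OF A g order_refl] q(2) LIMSEQ_unique by blast
qed

lemma op_fun_ident:
  fixes A :: "'a::complex_hilbert_space \<Rightarrow>\<^sub>L 'a"
  assumes A: "positive_op A"
  shows "op_fun (\<lambda>t. t) A = A"
proof -
  have "op_poly [:0, 1:] A = A" by (intro blinfun_eqI) (simp add: op_poly_pCons)
  moreover have "poly [:0, 1:] = (\<lambda>t::real. t)" by auto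
  ultimately show ?thesis using op_fun_poly[OF A, of "[:0, 1:]"] by simp
qed

lemma op_fun_const:
  fixes A :: "'a::complex_hilbert_space \<Rightarrow>\<^sub>L 'a"
  assumes A: "positive_op A"
  shows "op_fun (\<lambda>t. c) A x = c *\<^sub>R x"
proof -
  have "poly [:c:] = (\<lambda>t. c)" by auto
  then show ?thesis using op_fun_poly[OF A, of "[:c:]"] by (simp add: op_poly_const)
qed

lemma op_fun_const_minus:
  fixes A :: "'a::complex_hilbert_space \<Rightarrow>\<^sub>L 'a"
  assumes A: "positive_op A" and f: "continuous_on {0..} f"
  shows "op_fun (\<lambda>t. c - f t) A x = c *\<^sub>R x - op_fun f A x"
  by (simp add: op_fun_diff[OF A continuous_on_const f] blinfun.diff_left op_fun_const[OF A])

lemma op_fun_minus_const: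
  fixes A :: "'a::complex_hilbert_space \<Rightarrow>\<^sub>L 'a"
  assumes A: "positive_op A" and f: "continuous_on {0..} f"
  shows "op_fun (\<lambda>t. f t - c) A x = op_fun f A x - c *\<^sub>R x"
  by (simp add: op_fun_diff[OF A f continuous_on_const] blinfun.diff_left op_fun_const[OF A])

lemma continuous_on_powr_const:
  assumes "a > 0"
  shows "continuous_on {0..} (\<lambda>t::real. t powr a)"
  using assms by (intro continuous_on_powr' continuous_intros) auto

lemma op_poly_commute:
  fixes A N :: "'a::real_normed_vector \<Rightarrow>\<^sub>L 'a"
  assumes "\<And>x. N (A x) = A (N x)"
  shows "N (op_poly q A x) = op_poly q A (N x)"
  by (induction q) (simp_all add: op_poly_pCons blinfun.add_left blinfun.add_right blinfun.scaleR_left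
      blinfun.scaleR_right assms blinfun.zero_right)

lemma op_fun_commute:
  fixes A N :: "'a::complex_hilbert_space \<Rightarrow>\<^sub>L 'a"
  assumes A: "positive_op A" and f: "continuous_on {0..} f" and com: "\<And>x. N (A x) = A (N x)"
  shows "N (op_fun f A x) = op_fun f A (N x)"
proof -
  obtain q where "(\<lambda>n. op_poly (q n) A) \<longlonglongrightarrow> op_fun f A"
    using op_fun_approx[OF A f order_refl] by blast
  note lim = op_fun_apply_tendsto[OF this]
  have "(\<lambda>n. N (op_poly (q n) A x)) \<longlonglongrightarrow> N (op_fun f A x)"
    by (rule blinfun.tendsto[OF tendsto_const lim])
  then show ?thesis
    using lim[of "N x"] LIMSEQ_unique by (auto simp: op_poly_commute[OF com])
qed

lemma op_fun_norm_square:
  fixes A :: "'a::complex_hilbert_space \<Rightarrow>\<^sub>L 'a"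
  assumes A: "positive_op A" and f: "continuous_on {0..} f"
  shows "(norm (op_fun f A x))\<^sup>2 = inner (op_fun (\<lambda>t. f t * f t) A x) x"
  using op_fun_symmetric[OF A f]
  by (simp add: op_fun_mult[OF A f f] symmetric_op_def power2_norm_eq_inner)

text \<open>
  Vectors on which \<open>g(A)\<close> is asymptotically zero concentrate spectrally at the only zero
  \<open>\<tau>\<close> of \<open>g\<close>, so \<open>f(A)\<close> is asymptotically \<open>f(\<tau>) = 0\<close> on them. Quantitatively,
  \<open>f\<^sup>2 \<le> e + K g\<close> on \<open>{0..\<tau>}\<close> for every \<open>e > 0\<close> and a suitable \<open>K\<close>.
\<close>

lemma op_fun_sequence_transfer:
  fixes A :: "'a::complex_hilbert_space \<Rightarrow>\<^sub>L 'a"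
  assumes A: "positive_op A" and f: "continuous_on {0..} f" and g: "continuous_on {0..} g"
    and M: "subspace M" "\<And>x. x \<in> M \<Longrightarrow> A x \<in> M"
    and le: "\<And>x. x \<in> M \<Longrightarrow> inner (A x) x \<le> \<tau> * (norm x)\<^sup>2" and "\<tau> \<ge> 0"
    and f0: "f \<tau> = 0" and g0: "g \<tau> = 0" and gpos: "\<And>t. 0 \<le> t \<Longrightarrow> t < \<tau> \<Longrightarrow> g t > 0"
    and x: "\<And>k::nat. x k \<in> M" "\<And>k. norm (x k) = 1"
    and lim: "(\<lambda>k. inner (op_fun g A (x k)) (x k)) \<longlonglongrightarrow> 0"
  shows "(\<lambda>k. op_fun f A (x k)) \<longlonglongrightarrow> 0"
proof -
  have gnn: "g t \<ge> 0" if "0 \<le> t" "t \<le> \<tau>" for t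
    using gpos[of t] g0 that by (cases "t = \<tau>") auto
  have dominate: "\<exists>K\<ge>0. \<forall>t\<in>{0..\<tau>}. f t * f t \<le> e + K * g t" if "e > 0" for e
  proof -
    have "continuous_on {0..} (\<lambda>t. f t * f t)" using f by (intro continuous_intros)
    then obtain d where d: "d > 0" "\<And>t. t \<ge> 0 \<Longrightarrow> dist t \<tau> < d \<Longrightarrow> dist (f t * f t) (f \<tau> * f \<tau>) < e"
      using \<open>e > 0\<close> \<open>\<tau> \<ge> 0\<close> unfolding continuous_on_iff by (metis atLeast_iff)
    show ?thesis
    proof (cases "\<tau> - d \<ge> 0")
      case False
      have "f t * f t \<le> e" if "t \<in> {0..\<tau>}" for t
        using d(2)[of t] that False f0 by (simp add: dist_real_def)
      then show ?thesis by (intro exI[of _ 0]) simp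
    next
      case True
      let ?I = "{0..\<tau> - d}"
      have I: "compact ?I" "?I \<noteq> {}" using True by auto
      have "continuous_on ?I g" "continuous_on ?I (\<lambda>t. f t * f t)"
        by (rule continuous_on_subset[of "{0..}"], use f g in \<open>auto intro: continuous_intros\<close>)+
      then obtain s u where s: "s \<in> ?I" "\<And>t. t \<in> ?I \<Longrightarrow> g s \<le> g t"
        and u: "u \<in> ?I" "\<And>t. t \<in> ?I \<Longrightarrow> f t * f t \<le> f u * f u"
        using continuous_attains_inf[OF I, of g] continuous_attains_sup[OF I, of "\<lambda>t. f t * f t"] by blast
      have gs: "g s > 0" using gpos s(1) \<open>d > 0\<close> by simp
      define K where "K = f u * f u / g s"
      have K: "K \<ge> 0" using gs by (simp add: K_def)
      have "f t * f t \<le> e + K * g t" if t: "t \<in> {0..\<tau>}" for t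
      proof (cases "t \<in> ?I")
        case True
        have "f t * f t \<le> K * g s" using u(2)[OF True] gs by (simp add: K_def)
        also have "\<dots> \<le> K * g t" using s(2)[OF True] K by (rule mult_left_mono)
        finally show ?thesis using \<open>e > 0\<close> by simp
      next
        case False
        then have "f t * f t < e" using d(2)[of t] t f0 by (simp add: dist_real_def)
        moreover have "0 \<le> K * g t" using K gnn t by simp
        ultimately show ?thesis by linarith
      qed
      then show ?thesis using K by blast
    qed
  qed
  have "(\<lambda>k. (norm (op_fun f A (x k)))\<^sup>2) \<longlonglongrightarrow> 0"
  proof (rule LIMSEQ_I)
    fix e :: real assume "e > 0"
    then obtain K where K: "K \<ge> 0" "\<And>t. t \<in> {0..\<tau>} \<Longrightarrow> f t * f t \<le> e / 2 + K * g t"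
      using dominate[of "e / 2"] by auto
    \<comment> \<open>The function \<open>e / 2 + K g\<close>, with its constants written as polynomials so that the
      algebraic rules of the calculus evaluate it.\<close>
    have cont: "continuous_on {0..} (\<lambda>t. poly [:e / 2:] t - poly [:- K:] t * g t)"
      using g by (intro continuous_intros)
    have bound: "(norm (op_fun f A (x k)))\<^sup>2 \<le> e / 2 + K * inner (op_fun g A (x k)) (x k)" for k
    proof -
      have "(norm (op_fun f A (x k)))\<^sup>2
          \<le> inner (op_fun (\<lambda>t. poly [:e / 2:] t - poly [:- K:] t * g t) A (x k)) (x k)"
        unfolding op_fun_norm_square[OF A f]
        by (rule op_fun_mono_on[OF A _ cont M le _ x(1)]) (use f K in \<open>auto intro: continuous_intros\<close>)
      also have "op_fun (\<lambda>t. poly [:e / 2:] t - poly [:- K:] t * g t) A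
          = op_poly [:e / 2:] A - (op_poly [:- K:] A o\<^sub>L op_fun g A)"
      proof -
        have c: "continuous_on {0..} (poly q)" for q :: "real poly" by (intro continuous_intros)
        have "continuous_on {0..} (\<lambda>t. poly [:- K:] t * g t)" using g by (intro continuous_intros)
        then show ?thesis
          by (simp only: op_fun_diff[OF A c] op_fun_mult[OF A c g] op_fun_poly[OF A])
      qed
      also have "inner (\<dots> (x k)) (x k) = e / 2 + K * inner (op_fun g A (x k)) (x k)"
        using x(2) by (simp add: blinfun.diff_left op_poly_const inner_diff_left inner_add_left dot_square_norm)
      finally show ?thesis .
    qed
    have "(\<lambda>k. K * inner (op_fun g A (x k)) (x k)) \<longlonglongrightarrow> 0"
      using tendsto_mult_right_zero[OF lim] by simp
    then obtain N where N: "\<And>k. k \<ge> N \<Longrightarrow> \<bar>K * inner (op_fun g A (x k)) (x k)\<bar> < e / 2"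
      using \<open>e > 0\<close> LIMSEQ_D[of _ 0 "e / 2"] by fastforce
    then have "norm ((norm (op_fun f A (x k)))\<^sup>2 - 0) < e" if "k \<ge> N" for k
      using bound[of k] N[OF that] by (simp add: abs_less_iff)
    then show "\<exists>N. \<forall>k\<ge>N. norm ((norm (op_fun f A (x k)))\<^sup>2 - 0) < e" by blast
  qed
  then have "(\<lambda>k. sqrt ((norm (op_fun f A (x k)))\<^sup>2)) \<longlonglongrightarrow> sqrt 0" by (rule tendsto_real_sqrt)
  then show ?thesis by (simp add: tendsto_norm_zero_iff)
qed

section \<open>Orthogonal projections and adjoints\<close>

text \<open>
  A minimising sequence for the distance to \<open>M\<close> is Cauchy by the parallelogram law.
\<close>

lemma orthogonal_projection:
  fixes M :: "'a::{real_inner,complete_space} set"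
  assumes M: "subspace M" "closed M"
  obtains u where "u \<in> M" "\<And>y. y \<in> M \<Longrightarrow> inner (x - u) y = 0"
proof -
  define D where "D = Inf ((\<lambda>y. (norm (x - y))\<^sup>2) ` M)"
  have bdd: "bdd_below ((\<lambda>y. (norm (x - y))\<^sup>2) ` M)" by (rule bdd_belowI[of _ 0]) auto
  have ne: "M \<noteq> {}" using subspace_0[OF M(1)] by blast
  have low: "D \<le> (norm (x - y))\<^sup>2" if "y \<in> M" for y
    unfolding D_def by (rule cInf_lower) (use bdd that in auto)
  have "\<exists>y\<in>M. (norm (x - y))\<^sup>2 < D + 1 / real (Suc n)" for n
    using cInf_lessD[of "(\<lambda>y. (norm (x - y))\<^sup>2) ` M" "D + 1 / real (Suc n)"] ne by (auto simp: D_def)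
  then obtain y where y: "\<And>n. y n \<in> M" "\<And>n. (norm (x - y n))\<^sup>2 < D + 1 / real (Suc n)" by metis
  have para: "(norm (y m - y n))\<^sup>2 \<le> 2 * (1 / real (Suc m)) + 2 * (1 / real (Suc n))" for m n
  proof -
    have "(norm (y m - y n))\<^sup>2 = 2 * (norm (x - y m))\<^sup>2 + 2 * (norm (x - y n))\<^sup>2
        - 4 * (norm (x - (1/2) *\<^sub>R (y m + y n)))\<^sup>2"
      unfolding power2_norm_eq_inner
      by (simp add: inner_diff_left inner_diff_right inner_add_left inner_add_right inner_commute algebra_simps)
    moreover have "D \<le> (norm (x - (1/2) *\<^sub>R (y m + y n)))\<^sup>2"
      using y(1) M(1) by (intro low subspace_mul subspace_add)
    ultimately show ?thesis using y(2)[of m] y(2)[of n] by argo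
  qed
  have "Cauchy y"
    unfolding Cauchy_def
  proof (intro allI impI)
    fix e :: real assume "e > 0"
    then obtain N where N: "4 / e\<^sup>2 < real (Suc N)" using reals_Archimedean2 less_trans
      by (metis lessI of_nat_less_iff)
    have "dist (y m) (y n) < e" if "m \<ge> N" "n \<ge> N" for m n
    proof -
      have "(norm (y m - y n))\<^sup>2 \<le> 2 * (1 / real (Suc m)) + 2 * (1 / real (Suc n))" by (rule para)
      also have "\<dots> \<le> 2 * (1 / real (Suc N)) + 2 * (1 / real (Suc N))"
        using that by (intro add_mono mult_left_mono divide_left_mono) auto
      also have "\<dots> = 4 / real (Suc N)" by simp
      also have "\<dots> < e\<^sup>2" using N \<open>e > 0\<close> by (simp add: divide_less_eq mult.commute)
      finally show ?thesis unfolding dist_norm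
        using \<open>e > 0\<close> by (simp add: power_less_imp_less_base)
    qed
    then show "\<exists>N. \<forall>m\<ge>N. \<forall>n\<ge>N. dist (y m) (y n) < e" by blast
  qed
  then obtain u where u: "y \<longlonglongrightarrow> u" by (auto simp: Cauchy_convergent_iff convergent_def)
  have uM: "u \<in> M" using closed_sequentially[OF M(2)] y(1) u by blast
  have "(norm (x - u))\<^sup>2 \<le> D"
  proof (rule LIMSEQ_le)
    show "(\<lambda>n. (norm (x - y n))\<^sup>2) \<longlonglongrightarrow> (norm (x - u))\<^sup>2" by (intro tendsto_intros u)
    show "(\<lambda>n. D + 1 / real (Suc n)) \<longlonglongrightarrow> D"
      using tendsto_add[OF tendsto_const LIMSEQ_Suc[OF lim_1_over_n]] by force
    show "\<exists>N. \<forall>n\<ge>N. (norm (x - y n))\<^sup>2 \<le> D + 1 / real (Suc n)" using y(2) less_imp_le by blast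
  qed
  have "inner (x - u) v = 0" if v: "v \<in> M" for v
  proof (cases "v = 0")
    case False
    define t where "t = inner (x - u) v / (norm v)\<^sup>2"
    have "(norm (x - u))\<^sup>2 \<le> (norm (x - (u + t *\<^sub>R v)))\<^sup>2"
      using low[of "u + t *\<^sub>R v"] uM v M(1) \<open>(norm (x - u))\<^sup>2 \<le> D\<close>
      by (meson order_trans subspace_add subspace_mul)
    also have "\<dots> = (norm ((x - u) - t *\<^sub>R v))\<^sup>2" by (simp add: algebra_simps)
    also have "\<dots> = (norm (x - u))\<^sup>2 - 2 * t * inner (x - u) v + t\<^sup>2 * (norm v)\<^sup>2"
      unfolding power2_norm_eq_inner inner_diff_left[of "x - u"] inner_diff_right[of _ "x - u"]
      by (simp add: inner_commute power2_eq_square)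
    also have "\<dots> = (norm (x - u))\<^sup>2 - (inner (x - u) v)\<^sup>2 / (norm v)\<^sup>2"
      using False by (simp add: t_def power2_eq_square field_simps)
    finally have "(inner (x - u) v)\<^sup>2 / (norm v)\<^sup>2 \<le> 0" by simp
    then show ?thesis using False by (simp add: divide_le_0_iff)
  qed simp
  then show thesis using that uM by blast
qed

text \<open>
  The representing vector is a multiple of the component of some \<open>z\<close> outside the kernel that
  is orthogonal to the kernel.
\<close>

lemma riesz_representation:
  fixes \<phi> :: "'a::{real_inner,complete_space} \<Rightarrow> real"
  assumes "bounded_linear \<phi>"
  obtains w where "\<And>x. \<phi> x = inner x w"
proof (cases "\<forall>x. \<phi> x = 0")
  case True
  then show thesis using that[of 0] by simp
next
  case False
  then obtain z where z: "\<phi> z \<noteq> 0" by blast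
  interpret \<phi>: bounded_linear \<phi> by fact
  let ?M = "{x. \<phi> x = 0}"
  have "subspace ?M" by (simp add: subspace_def \<phi>.zero \<phi>.add \<phi>.scaleR)
  moreover have "closed ?M"
    by (intro closed_Collect_eq continuous_intros linear_continuous_on assms)
  ultimately obtain u where "u \<in> ?M" "\<And>y. y \<in> ?M \<Longrightarrow> inner (z - u) y = 0"
    by (rule orthogonal_projection[of ?M z]) blast
  then have u: "\<phi> u = 0" "\<And>y. \<phi> y = 0 \<Longrightarrow> inner (z - u) y = 0" by simp_all
  define v where "v = z - u"
  have v: "\<phi> v \<noteq> 0" using z u by (simp add: v_def \<phi>.diff)
  then have "v \<noteq> 0" using \<phi>.zero by metis
  then have v0: "inner v v \<noteq> 0" by simp
  have "\<phi> x = inner x ((\<phi> v / inner v v) *\<^sub>R v)" for x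
  proof -
    have "\<phi> (x - (\<phi> x / \<phi> v) *\<^sub>R v) = 0" using v by (simp add: \<phi>.diff \<phi>.scaleR)
    then have "inner v (x - (\<phi> x / \<phi> v) *\<^sub>R v) = 0" using u(2) by (simp add: v_def)
    then have "inner x v = \<phi> x / \<phi> v * inner v v" by (simp add: inner_diff_right inner_commute)
    then show ?thesis using v v0 by simp
  qed
  then show thesis using that by blast
qed

lemma real_adjoint_exists:
  fixes T :: "'a::{real_inner,complete_space} \<Rightarrow>\<^sub>L 'a"
  obtains S :: "'a \<Rightarrow>\<^sub>L 'a" where "\<And>x y. inner (T x) y = inner x (S y)"
proof -
  have "\<exists>w. \<forall>x. inner (T x) y = inner x w" for y
  proof -
    have "bounded_linear (\<lambda>x. inner (T x) y)"
      by (rule bounded_linear_compose[OF bounded_linear_inner_left blinfun.bounded_linear_right])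
    then show ?thesis using riesz_representation by blast
  qed
  then obtain s where s: "\<And>x y. inner (T x) y = inner x (s y)" by metis
  have eqI: "a = b" if "\<And>x. inner x a = inner x b" for a b :: 'a
    using that vector_eq_ldot by blast
  have "bounded_linear s"
  proof (rule bounded_linear_intro[of _ "norm T"])
    show "s (x + y) = s x + s y" for x y
      by (rule eqI) (simp add: s[symmetric] inner_add_right)
    show "s (r *\<^sub>R x) = r *\<^sub>R s x" for r x
      by (rule eqI) (simp add: s[symmetric])
    show "norm (s x) \<le> norm x * norm T" for x
    proof (cases "s x = 0")
      case False
      have "norm (s x) * norm (s x) = inner (T (s x)) x" by (simp add: s dot_square_norm power2_eq_square)
      also have "\<dots> \<le> norm (T (s x)) * norm x" by (rule norm_cauchy_schwarz)
      also have "\<dots> \<le> norm T * norm (s x) * norm x" by (intro mult_right_mono norm_blinfun) auto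
      finally show ?thesis using False by (simp add: mult.commute mult.left_commute)
    qed simp
  qed
  then show thesis using that[of "Blinfun s"] s by (simp add: bounded_linear_Blinfun_apply)
qed

text \<open>
  The complex inner product is determined by the real one, so the complex adjoint of a
  complex-linear operator is its real adjoint.
\<close>

lemma cinner_eq_inner:
  "cinner x y = Complex (inner x y) (inner x (\<i> *\<^sub>C (y::'a::complex_hilbert_space)))"
proof -
  have "cinner x (\<i> *\<^sub>C y) = cnj (cinner (\<i> *\<^sub>C y) x)" by (rule cinner_commute)
  also have "\<dots> = - \<i> * cnj (cinner y x)" by (simp add: cinner_scaleC_left)
  also have "cnj (cinner y x) = cinner x y" by (rule cinner_commute[symmetric])
  finally show ?thesis by (simp add: inner_eq_Re_cinner complex_eq_iff)
qed

lemma inner_adj: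
  fixes T :: "'a::complex_hilbert_space \<Rightarrow>\<^sub>L 'a"
  assumes "complex_linear (blinfun_apply T)"
  shows "inner (T x) y = inner x (adj T y)"
    and "adj (adj T) = T"
proof -
  have Ti: "T (c *\<^sub>C x) = c *\<^sub>C T x" for c x using assms by (simp add: complex_linear_def)
  have eqI: "a = b" if "\<And>x. inner x a = inner x b" for a b :: 'a
    using that vector_eq_ldot by blast
  obtain S :: "'a \<Rightarrow>\<^sub>L 'a" where S: "\<And>x y. inner (T x) y = inner x (S y)"
    using real_adjoint_exists by blast
  have move: "inner (\<i> *\<^sub>C x) y = - inner x (\<i> *\<^sub>C y)" for x y :: 'a
  proof -
    have "Re (cinner (\<i> *\<^sub>C x) y) = - Im (cinner x y)" by (simp add: cinner_scaleC_left)
    also have "\<dots> = - inner x (\<i> *\<^sub>C y)" by (simp add: cinner_eq_inner)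
    finally show ?thesis by (simp add: inner_eq_Re_cinner)
  qed
  have Si: "S (\<i> *\<^sub>C y) = \<i> *\<^sub>C S y" for y
  proof (rule eqI)
    fix x
    have "inner x (S (\<i> *\<^sub>C y)) = inner (T x) (\<i> *\<^sub>C y)" by (simp add: S)
    also have "\<dots> = - inner (T (\<i> *\<^sub>C x)) y" by (simp add: move Ti)
    also have "\<dots> = inner x (\<i> *\<^sub>C S y)" by (simp add: S move)
    finally show "inner x (S (\<i> *\<^sub>C y)) = inner x (\<i> *\<^sub>C S y)" .
  qed
  have cS: "cinner (T x) y = cinner x (S y)" for x y
    by (simp add: cinner_eq_inner S Si)
  have "\<exists>!S :: 'a \<Rightarrow>\<^sub>L 'a. \<forall>x y. cinner (T x) y = cinner x (S y)"
  proof (rule ex1I[of _ S])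
    show "R = S" if "\<forall>x y. cinner (T x) y = cinner x (R y)" for R :: "'a \<Rightarrow>\<^sub>L 'a"
    proof (rule blinfun_eqI, rule eqI)
      show "inner x (R y) = inner x (S y)" for x y
        using that cS unfolding inner_eq_Re_cinner by simp
    qed
  qed (use cS in blast)
  then have adj: "adj T = S" unfolding adj_def using cS by (intro the1_equality) auto
  show "inner (T x) y = inner x (adj T y)" by (simp add: adj S)
  have cT: "cinner (S x) y = cinner x (T y)" for x y
    using cS[of y x] cinner_commute[of "S x" y] cinner_commute[of x "T y"] by simp
  have "\<exists>!R :: 'a \<Rightarrow>\<^sub>L 'a. \<forall>x y. cinner (S x) y = cinner x (R y)"
  proof (rule ex1I[of _ T])
    show "R = T" if "\<forall>x y. cinner (S x) y = cinner x (R y)" for R :: "'a \<Rightarrow>\<^sub>L 'a"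
    proof (rule blinfun_eqI, rule eqI)
      show "inner x (R y) = inner x (T y)" for x y
        using that cT unfolding inner_eq_Re_cinner by simp
    qed
  qed (use cT in blast)
  then show "adj (adj T) = T" unfolding adj unfolding adj_def[of S] using cT by (intro the1_equality) auto
qed

section \<open>Absolute paranormality on reducing subspaces\<close>

text \<open>
  Adjointness for the real inner product, symmetric in both operators; it keeps the arguments
  free of the description operator in \<open>adj\<close>.
\<close>

definition adjoint_pair :: "('a::real_inner \<Rightarrow>\<^sub>L 'a) \<Rightarrow> ('a \<Rightarrow>\<^sub>L 'a) \<Rightarrow> bool" where
  "adjoint_pair T S \<longleftrightarrow> (\<forall>x y. inner (T x) y = inner x (S y))"

lemma adjoint_pair_sym: "adjoint_pair T S \<Longrightarrow> adjoint_pair S T"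
  unfolding adjoint_pair_def by (metis inner_commute)

lemma adjoint_pair_positive:
  assumes "adjoint_pair T S"
  shows "positive_op (S o\<^sub>L T)"
proof -
  have "inner (S (T x)) y = inner (T x) (T y)" "inner x (S (T y)) = inner (T x) (T y)" for x y
    using assms adjoint_pair_sym[OF assms] by (auto simp: adjoint_pair_def)
  then show ?thesis by (simp add: positive_op_def symmetric_op_def)
qed

lemma adjoint_pair_norm_le_on:
  fixes T S :: "'a::real_inner \<Rightarrow>\<^sub>L 'a"
  assumes ad: "adjoint_pair T S" and "\<tau> \<ge> 0"
    and SM: "\<And>x. x \<in> M \<Longrightarrow> S x \<in> M"
    and le: "\<And>x. x \<in> M \<Longrightarrow> norm (T x) \<le> \<tau> * norm x" and x: "x \<in> M"
  shows "norm (S x) \<le> \<tau> * norm x"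
proof (cases "S x = 0")
  case False
  have "norm (S x) * norm (S x) = inner (T (S x)) x"
    using ad by (simp add: adjoint_pair_def flip: dot_square_norm power2_eq_square)
  also have "\<dots> \<le> norm (T (S x)) * norm x" by (rule norm_cauchy_schwarz)
  also have "\<dots> \<le> \<tau> * norm (S x) * norm x" by (intro mult_right_mono le SM x) auto
  finally show ?thesis using False by (simp add: mult.commute mult.left_commute)
qed (use \<open>\<tau> \<ge> 0\<close> in simp)

context
  fixes T :: "'a::complex_hilbert_space \<Rightarrow>\<^sub>L 'a"
  assumes ad: "adjoint_pair T (adj T)"
begin

lemma op_abs_positive: "positive_op (op_abs T)"
proof -
  note D = adjoint_pair_positive[OF ad]
  have c: "continuous_on {0..} (\<lambda>t::real. t powr (1/2))" by (rule continuous_on_powr_const) simp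
  have "inner ((adj T o\<^sub>L T) x) x \<le> norm (adj T o\<^sub>L T) * (norm x)\<^sup>2" for x
  proof -
    have "inner ((adj T o\<^sub>L T) x) x \<le> norm ((adj T o\<^sub>L T) x) * norm x" by (rule norm_cauchy_schwarz)
    also have "\<dots> \<le> norm (adj T o\<^sub>L T) * norm x * norm x"
      by (intro mult_right_mono norm_blinfun) auto
    finally show ?thesis by (simp add: power2_eq_square mult.assoc)
  qed
  then have "0 \<le> inner (op_abs T x) x" for x
    unfolding op_abs_def op_powr_def
    by (intro op_fun_nonneg_on[OF D c, where M = UNIV]) auto
  then show ?thesis unfolding positive_op_def
    using op_fun_symmetric[OF D c] by (simp add: op_abs_def op_powr_def)
qed

lemma op_abs_square: "op_abs T (op_abs T x) = adj T (T x)"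
proof -
  note D = adjoint_pair_positive[OF ad]
  have c: "continuous_on {0..} (\<lambda>t::real. t powr (1/2))" by (rule continuous_on_powr_const) simp
  have "op_abs T o\<^sub>L op_abs T = op_fun (\<lambda>t. t powr (1/2) * t powr (1/2)) (adj T o\<^sub>L T)"
    unfolding op_abs_def op_powr_def op_fun_mult[OF D c c] ..
  also have "\<dots> = op_fun (\<lambda>t. t) (adj T o\<^sub>L T)"
    by (rule op_fun_cong[OF D]) (use c in \<open>auto intro: continuous_intros simp flip: powr_add\<close>)
  also have "\<dots> = adj T o\<^sub>L T" by (rule op_fun_ident[OF D])
  finally have "(op_abs T o\<^sub>L op_abs T) x = (adj T o\<^sub>L T) x" by simp
  then show ?thesis by simp
qed

lemma norm_op_abs: "norm (op_abs T x) = norm (T x)"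
proof -
  have "inner (op_abs T x) (op_abs T x) = inner (op_abs T (op_abs T x)) x"
    using op_abs_positive by (simp add: positive_op_def symmetric_op_def)
  also have "\<dots> = inner (T x) (T x)"
    unfolding op_abs_square using adjoint_pair_sym[OF ad] by (simp add: adjoint_pair_def)
  finally show ?thesis by (simp add: norm_eq_sqrt_inner)
qed

lemma op_abs_invariant:
  assumes "subspace M" "closed M" "\<And>x. x \<in> M \<Longrightarrow> T x \<in> M" "\<And>x. x \<in> M \<Longrightarrow> adj T x \<in> M" "x \<in> M"
  shows "op_abs T x \<in> M"
  unfolding op_abs_def op_powr_def
  by (rule op_fun_invariant[OF adjoint_pair_positive[OF ad] continuous_on_powr_const])
    (use assms in auto)

lemma op_abs_form_le:
  assumes "norm (T x) \<le> \<tau> * norm x"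
  shows "inner (op_abs T x) x \<le> \<tau> * (norm x)\<^sup>2"
proof -
  have "inner (op_abs T x) x \<le> norm (op_abs T x) * norm x" by (rule norm_cauchy_schwarz)
  also have "\<dots> \<le> \<tau> * norm x * norm x"
    unfolding norm_op_abs using assms by (rule mult_right_mono) simp
  finally show ?thesis by (simp add: power2_eq_square mult.assoc)
qed

end

lemma tendsto_of_lower_bound_tendsto:
  fixes a b :: "nat \<Rightarrow> real"
  assumes "\<And>k. l k \<le> a k" "l \<longlonglongrightarrow> L" "\<And>k. a k \<le> L"
  shows "a \<longlonglongrightarrow> L"
  by (rule tendsto_sandwich[OF _ _ assms(2) tendsto_const]) (use assms in auto)

lemma norm_tendsto_of_diff_tendsto:
  fixes x y :: "nat \<Rightarrow> 'a::real_normed_vector"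
  assumes lim: "(\<lambda>k. y k - c *\<^sub>R x k) \<longlonglongrightarrow> 0" and x: "\<And>k. norm (x k) = 1" and "c \<ge> 0"
  shows "(\<lambda>k. norm (y k)) \<longlonglongrightarrow> c"
proof -
  have "(\<lambda>k. norm (y k) - c) \<longlonglongrightarrow> 0"
  proof (rule Lim_null_comparison[OF _ tendsto_norm_zero[OF lim]])
    have "\<bar>norm (y k) - c\<bar> \<le> norm (y k - c *\<^sub>R x k)" for k
      using norm_triangle_ineq3[of "y k" "c *\<^sub>R x k"] x \<open>c \<ge> 0\<close> by simp
    then show "\<forall>\<^sub>F k in sequentially. norm (norm (y k) - c) \<le> norm (y k - c *\<^sub>R x k)" by simp
  qed
  then show ?thesis by (simp add: LIM_zero_iff)
qed

text \<open>
  The inequality gives \<open>norm (|T|\<^sup>p x\<^sub>k) \<ge> l k \<rightarrow> \<tau> powr p\<close> because \<open>|T\<^sup>*|\<^sup>r x\<^sub>k\<close>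
  may be replaced by \<open>(\<tau> powr r) x\<^sub>k\<close>; as \<open>\<tau> powr p\<close> is also an upper bound,
  \<open>x\<^sub>k\<close> concentrates where \<open>|T|\<close> equals \<open>\<tau>\<close>.
\<close>

lemma paranormal_norming_sequence:
  fixes T :: "'a::complex_hilbert_space \<Rightarrow>\<^sub>L 'a"
  assumes ad: "adjoint_pair T (adj T)" and adad: "adj (adj T) = T"
    and pr: "p > 0" "r > 0" and para: "absolute_paranormal p r T"
    and M: "subspace M" "closed M" "\<And>x. x \<in> M \<Longrightarrow> T x \<in> M" "\<And>x. x \<in> M \<Longrightarrow> adj T x \<in> M"
    and \<tau>: "\<tau> > 0" "\<And>x. x \<in> M \<Longrightarrow> norm (T x) \<le> \<tau> * norm x"
    and x: "\<And>k::nat. x k \<in> M" "\<And>k. norm (x k) = 1"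
    and lim: "(\<lambda>k. norm (adj T (x k))) \<longlonglongrightarrow> \<tau>"
  shows "(\<lambda>k. adj T (T (x k)) - \<tau>\<^sup>2 *\<^sub>R x k) \<longlonglongrightarrow> 0"
proof -
  define A where "A = op_abs T"
  define B where "B = op_abs (adj T)"
  have ad': "adjoint_pair (adj T) (adj (adj T))" using adjoint_pair_sym[OF ad] adad by simp
  have A: "positive_op A" and B: "positive_op B"
    using op_abs_positive[OF ad] op_abs_positive[OF ad'] by (simp_all add: A_def B_def)
  have AM: "A y \<in> M" and BM: "B y \<in> M" if "y \<in> M" for y
    using op_abs_invariant[OF ad M that] op_abs_invariant[OF ad' M(1,2)] M(3,4) that adad
    by (simp_all add: A_def B_def)
  have Ale: "inner (A y) y \<le> \<tau> * (norm y)\<^sup>2" if "y \<in> M" for y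
    unfolding A_def by (rule op_abs_form_le[OF ad \<tau>(2)[OF that]])
  have Ble: "inner (B y) y \<le> \<tau> * (norm y)\<^sup>2" if "y \<in> M" for y
    unfolding B_def
    by (rule op_abs_form_le[OF ad' adjoint_pair_norm_le_on[OF ad _ M(4) \<tau>(2) that]]) (use \<tau> in auto)
  note cp = continuous_on_powr_const[OF pr(1)] and cr = continuous_on_powr_const[OF pr(2)]
  have cpp: "continuous_on {0..} (\<lambda>t::real. t powr p * t powr p)" by (rule continuous_on_mult[OF cp cp])
  have csq: "continuous_on {0..} (\<lambda>t::real. t * t)" by (intro continuous_intros)
  have AA: "op_fun (\<lambda>t. t * t) A y = adj T (T y)" for y
    unfolding op_fun_mult[OF A continuous_on_id continuous_on_id] op_fun_ident[OF A]
    by (simp add: A_def op_abs_square[OF ad])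
  have BB: "op_fun (\<lambda>t. t * t) B y = T (adj T y)" for y
    unfolding op_fun_mult[OF B continuous_on_id continuous_on_id] op_fun_ident[OF B]
    by (simp add: B_def op_abs_square[OF ad'] adad)
  have "(\<lambda>k. op_fun (\<lambda>t. t powr r - \<tau> powr r) B (x k)) \<longlonglongrightarrow> 0"
  proof (rule op_fun_sequence_transfer[where g = "\<lambda>t. \<tau> * \<tau> - t * t" and M = M and \<tau> = \<tau>, OF B])
    show "(\<lambda>k. inner (op_fun (\<lambda>t. \<tau> * \<tau> - t * t) B (x k)) (x k)) \<longlonglongrightarrow> 0"
    proof -
      have "inner (op_fun (\<lambda>t. \<tau> * \<tau> - t * t) B (x k)) (x k) = \<tau>\<^sup>2 - (norm (adj T (x k)))\<^sup>2" for k
        using ad x(2)[of k] by (simp add: op_fun_const_minus[OF B csq] BB inner_diff_left dot_square_norm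
            adjoint_pair_def power2_eq_square)
      moreover have "(\<lambda>k. \<tau>\<^sup>2 - (norm (adj T (x k)))\<^sup>2) \<longlonglongrightarrow> \<tau>\<^sup>2 - \<tau>\<^sup>2"
        by (intro tendsto_intros lim)
      ultimately show ?thesis by simp
    qed
    show "\<tau> * \<tau> - t * t > 0" if "0 \<le> t" "t < \<tau>" for t
      using mult_strict_mono'[of t \<tau> t \<tau>] that by simp
  qed (use x M(1) BM Ble \<tau>(1) cr in \<open>auto intro!: continuous_intros\<close>)
  then have Blim: "(\<lambda>k. op_powr B r (x k) - \<tau> powr r *\<^sub>R x k) \<longlonglongrightarrow> 0"
    by (simp add: op_fun_minus_const[OF B cr] op_powr_def)
  define y where "y k = op_powr B r (x k)" for k
  have ynorm: "(\<lambda>k. norm (y k)) \<longlonglongrightarrow> \<tau> powr r"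
    by (rule norm_tendsto_of_diff_tendsto[OF _ x(2)]) (use Blim in \<open>auto simp: y_def\<close>)
  have para': "norm (y k) powr ((p + r) / r) \<le> norm (op_powr A p (y k))" for k
  proof -
    have "norm (y k) powr (p + r) \<le> norm (op_powr A p (y k)) powr r"
      using para x(2) by (simp add: absolute_paranormal_def y_def A_def B_def)
    then have "(norm (y k) powr (p + r)) powr (1 / r) \<le> (norm (op_powr A p (y k)) powr r) powr (1 / r)"
      using pr by (intro powr_mono2) auto
    then show ?thesis using pr by (simp add: powr_powr)
  qed
  define l where "l k = (norm (y k) powr ((p + r) / r) - norm (op_powr A p (y k - \<tau> powr r *\<^sub>R x k))) / \<tau> powr r" for k
  have "l k \<le> norm (op_powr A p (x k))" for k
  proof -
    have "op_powr A p (y k) = op_powr A p (y k - \<tau> powr r *\<^sub>R x k) + \<tau> powr r *\<^sub>R op_powr A p (x k)"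
      by (simp add: blinfun.diff_right blinfun.scaleR_right)
    then have "norm (op_powr A p (y k)) \<le> norm (op_powr A p (y k - \<tau> powr r *\<^sub>R x k)) + \<tau> powr r * norm (op_powr A p (x k))"
      using norm_triangle_ineq[of "op_powr A p (y k - \<tau> powr r *\<^sub>R x k)" "\<tau> powr r *\<^sub>R op_powr A p (x k)"]
      by simp
    then show ?thesis using para'[of k] \<tau>(1) by (simp add: l_def divide_le_eq mult.commute)
  qed
  moreover have "l \<longlonglongrightarrow> \<tau> powr p"
  proof -
    have "(\<lambda>k. norm (op_powr A p (y k - \<tau> powr r *\<^sub>R x k))) \<longlonglongrightarrow> norm (op_powr A p 0)"
      by (intro tendsto_norm blinfun.tendsto tendsto_const) (use Blim in \<open>simp add: y_def\<close>)
    then have "l \<longlonglongrightarrow> ((\<tau> powr r) powr ((p + r) / r) - norm (op_powr A p 0)) / \<tau> powr r"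
      unfolding l_def using \<tau>(1)
      by (intro tendsto_divide tendsto_diff tendsto_powr tendsto_const ynorm) auto
    moreover have "((\<tau> powr r) powr ((p + r) / r) - norm (op_powr A p 0)) / \<tau> powr r = \<tau> powr p"
      using pr \<tau>(1) by (simp add: powr_powr powr_add blinfun.zero_right)
    ultimately show ?thesis by simp
  qed
  moreover have "norm (op_powr A p (x k)) \<le> \<tau> powr p" for k
  proof -
    have "(norm (op_powr A p (x k)))\<^sup>2 \<le> inner (op_fun (\<lambda>t. \<tau> powr p * \<tau> powr p) A (x k)) (x k)"
      unfolding op_powr_def op_fun_norm_square[OF A cp]
      by (rule op_fun_mono_on[OF A cpp continuous_on_const M(1) AM Ale _ x(1)])
        (use pr in \<open>auto intro!: mult_mono powr_mono2\<close>)
    also have "\<dots> = (\<tau> powr p)\<^sup>2"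
      using x(2) by (simp add: op_fun_const[OF A] dot_square_norm power2_eq_square)
    finally show ?thesis by (rule power2_le_imp_le) simp
  qed
  ultimately have Anorm: "(\<lambda>k. norm (op_powr A p (x k))) \<longlonglongrightarrow> \<tau> powr p"
    by (rule tendsto_of_lower_bound_tendsto)
  have "(\<lambda>k. op_fun (\<lambda>t. t * t - \<tau>\<^sup>2) A (x k)) \<longlonglongrightarrow> 0"
  proof (rule op_fun_sequence_transfer[where g = "\<lambda>t. \<tau> powr p * \<tau> powr p - t powr p * t powr p"
        and M = M and \<tau> = \<tau>, OF A])
    show "(\<lambda>k. inner (op_fun (\<lambda>t. \<tau> powr p * \<tau> powr p - t powr p * t powr p) A (x k)) (x k)) \<longlonglongrightarrow> 0"
    proof -
      have "inner (op_fun (\<lambda>t. \<tau> powr p * \<tau> powr p - t powr p * t powr p) A (x k)) (x k)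
          = (\<tau> powr p)\<^sup>2 - (norm (op_powr A p (x k)))\<^sup>2" for k
        using x(2)[of k]
        by (simp add: op_fun_const_minus[OF A cpp] inner_diff_left dot_square_norm op_powr_def
            op_fun_norm_square[OF A cp] power2_eq_square[of "\<tau> powr p"])
      moreover have "(\<lambda>k. (\<tau> powr p)\<^sup>2 - (norm (op_powr A p (x k)))\<^sup>2) \<longlonglongrightarrow> (\<tau> powr p)\<^sup>2 - (\<tau> powr p)\<^sup>2"
        by (intro tendsto_intros Anorm)
      ultimately show ?thesis by simp
    qed
    show "\<tau> powr p * \<tau> powr p - t powr p * t powr p > 0" if "0 \<le> t" "t < \<tau>" for t
    proof -
      have "t powr p < \<tau> powr p" using that pr by (intro powr_less_mono2) auto
      then show ?thesis using mult_strict_mono'[of "t powr p" "\<tau> powr p" "t powr p" "\<tau> powr p"] by simp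
    qed
  qed (use x M(1) AM Ale \<tau>(1) cp in \<open>auto intro!: continuous_intros simp: power2_eq_square\<close>)
  then show ?thesis by (simp add: op_fun_minus_const[OF A csq] AA)
qed

lemma op_power_Suc_right: "op_power A (Suc k) x = op_power A k (A x)"
  by (induction k arbitrary: x) auto

text \<open>
  By the previous lemma the normalised vectors \<open>T x\<^sub>k\<close> satisfy the same hypotheses as
  \<open>x\<^sub>k\<close>, so each further application of \<open>T\<close> gains another factor \<open>\<tau>\<close>.
\<close>

lemma paranormal_power_norming_sequence:
  fixes T :: "'a::complex_hilbert_space \<Rightarrow>\<^sub>L 'a"
  assumes ad: "adjoint_pair T (adj T)" and adad: "adj (adj T) = T"
    and pr: "p > 0" "r > 0" and para: "absolute_paranormal p r T"
    and M: "subspace M" "closed M" "\<And>x. x \<in> M \<Longrightarrow> T x \<in> M" "\<And>x. x \<in> M \<Longrightarrow> adj T x \<in> M"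
    and \<tau>: "\<tau> > 0" "\<And>x. x \<in> M \<Longrightarrow> norm (T x) \<le> \<tau> * norm x"
    and x: "\<And>k::nat. x k \<in> M" "\<And>k. norm (x k) = 1"
    and lim: "(\<lambda>k. norm (adj T (x k))) \<longlonglongrightarrow> \<tau>"
  shows "(\<lambda>k. norm (op_power T j (x k))) \<longlonglongrightarrow> \<tau> ^ j"
  using x lim
proof (induction j arbitrary: x)
  case 0
  then show ?case by simp
next
  case (Suc j)
  have TT: "(\<lambda>k. norm (adj T (T (x k)))) \<longlonglongrightarrow> \<tau>\<^sup>2"
    by (rule norm_tendsto_of_diff_tendsto[OF
          paranormal_norming_sequence[OF ad adad pr para M \<tau> Suc.prems] Suc.prems(2)]) auto
  have T1: "(\<lambda>k. norm (T (x k))) \<longlonglongrightarrow> \<tau>"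
  proof (rule tendsto_of_lower_bound_tendsto)
    show "norm (adj T (T (x k))) / \<tau> \<le> norm (T (x k))" for k
      using adjoint_pair_norm_le_on[OF ad _ M(4) \<tau>(2) M(3)[OF Suc.prems(1)]] \<tau>(1)
      by (simp add: divide_le_eq mult.commute)
    show "(\<lambda>k. norm (adj T (T (x k))) / \<tau>) \<longlonglongrightarrow> \<tau>"
      using tendsto_divide[OF TT tendsto_const, of \<tau>] \<tau>(1) by (simp add: power2_eq_square)
    show "norm (T (x k)) \<le> \<tau>" for k using \<tau>(2)[OF Suc.prems(1)] Suc.prems(2) by simp
  qed
  \<comment> \<open>\<open>T (x k)\<close> is nonzero only eventually; the other branch keeps \<open>y k\<close> a unit vector of \<open>M\<close>
    with \<open>T (x k)\<close> as a multiple.\<close>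
  define y where "y k = (if T (x k) = 0 then x k else (1 / norm (T (x k))) *\<^sub>R T (x k))" for k
  have y: "y k \<in> M" "norm (y k) = 1" "T (x k) = norm (T (x k)) *\<^sub>R y k" for k
    using Suc.prems(1,2) M by (auto simp: y_def subspace_mul)
  have "(\<lambda>k. norm (adj T (T (x k))) / norm (T (x k))) \<longlonglongrightarrow> \<tau>"
    using tendsto_divide[OF TT T1] \<tau>(1) by (simp add: power2_eq_square)
  moreover have "\<forall>\<^sub>F k in sequentially. norm (adj T (T (x k))) / norm (T (x k)) = norm (adj T (y k))"
    using order_tendstoD(1)[OF T1 \<tau>(1)]
  proof eventually_elim
    case (elim k)
    have "norm (adj T (T (x k))) = norm (T (x k)) * norm (adj T (y k))"
      by (subst y(3)) (simp add: blinfun.scaleR_right)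
    then show ?case using elim by simp
  qed
  ultimately have "(\<lambda>k. norm (adj T (y k))) \<longlonglongrightarrow> \<tau>" by (rule Lim_transform_eventually)
  then have "(\<lambda>k. norm (op_power T j (y k))) \<longlonglongrightarrow> \<tau> ^ j" by (intro Suc.IH y)
  then have "(\<lambda>k. norm (T (x k)) * norm (op_power T j (y k))) \<longlonglongrightarrow> \<tau> * \<tau> ^ j"
    by (intro tendsto_mult T1)
  moreover have "norm (op_power T (Suc j) (x k)) = norm (T (x k)) * norm (op_power T j (y k))" for k
    unfolding op_power_Suc_right by (subst y(3)) (simp add: blinfun.scaleR_right)
  ultimately show ?case by simp
qed

text \<open>
  If the norm \<open>\<tau>\<close> of \<open>T\<close> on \<open>M\<close> exceeded \<open>b\<close>, a norming sequence for the adjoint would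
  make \<open>norm (op_power T n x)\<close> approach \<open>\<tau> ^ n > b ^ n\<close>.
\<close>

lemma paranormal_norm_le_of_power:
  fixes T :: "'a::complex_hilbert_space \<Rightarrow>\<^sub>L 'a"
  assumes ad: "adjoint_pair T (adj T)" and adad: "adj (adj T) = T"
    and pr: "p > 0" "r > 0" and para: "absolute_paranormal p r T"
    and M: "subspace M" "closed M" "\<And>x. x \<in> M \<Longrightarrow> T x \<in> M" "\<And>x. x \<in> M \<Longrightarrow> adj T x \<in> M"
    and n: "n > 0" and b: "b \<ge> 0" "\<And>x. x \<in> M \<Longrightarrow> norm (op_power T n x) \<le> b ^ n * norm x"
    and x: "x \<in> M"
  shows "norm (T x) \<le> b * norm x"
proof (cases "x = 0")
  case False
  define V where "V = {norm (adj T y) | y. y \<in> M \<and> norm y = 1}"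
  define \<tau> where "\<tau> = Sup V"
  have bdd: "bdd_above V"
  proof (rule bdd_aboveI[of _ "norm (adj T)"])
    show "v \<le> norm (adj T)" if "v \<in> V" for v
    proof -
      obtain y where "norm y = 1" "v = norm (adj T y)" using \<open>v \<in> V\<close> by (auto simp: V_def)
      then show ?thesis using norm_blinfun[of "adj T" y] by simp
    qed
  qed
  have "(1 / norm x) *\<^sub>R x \<in> M" "norm ((1 / norm x) *\<^sub>R x) = 1"
    using False x M(1) by (auto intro: subspace_mul)
  then have ne: "V \<noteq> {}" unfolding V_def by blast
  have S\<tau>: "norm (adj T y) \<le> \<tau> * norm y" if "y \<in> M" for y
  proof (cases "y = 0")
    case False
    have "(1 / norm y) *\<^sub>R y \<in> M" "norm ((1 / norm y) *\<^sub>R y) = 1"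
      using False that M(1) by (auto intro: subspace_mul)
    then have "norm (adj T ((1 / norm y) *\<^sub>R y)) \<le> \<tau>"
      unfolding \<tau>_def by (intro cSup_upper bdd) (auto simp: V_def)
    then show ?thesis using False by (simp add: blinfun.scaleR_right divide_le_eq)
  qed simp
  have "\<tau> \<ge> 0"
  proof -
    obtain v where "v \<in> V" using ne by blast
    then have "0 \<le> v" "v \<le> \<tau>" using cSup_upper[OF _ bdd] by (auto simp: V_def \<tau>_def)
    then show ?thesis by linarith
  qed
  have T\<tau>: "norm (T y) \<le> \<tau> * norm y" if "y \<in> M" for y
    by (rule adjoint_pair_norm_le_on[OF adjoint_pair_sym[OF ad] \<open>\<tau> \<ge> 0\<close> M(3) S\<tau> that])
  have "\<tau> \<le> b"
  proof (rule ccontr)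
    assume "\<not> \<tau> \<le> b"
    then have \<tau>b: "\<tau> > b" "\<tau> > 0" using b(1) by auto
    have "\<exists>y. y \<in> M \<and> norm y = 1 \<and> \<tau> - 1 / real (Suc k) \<le> norm (adj T y)" for k
    proof -
      have "\<tau> - 1 / real (Suc k) < Sup V" by (simp add: \<tau>_def)
      then obtain v where "v \<in> V" "\<tau> - 1 / real (Suc k) < v" using less_cSupD[OF ne] by blast
      then show ?thesis unfolding V_def by auto
    qed
    then obtain z where z: "\<And>k. z k \<in> M" "\<And>k. norm (z k) = 1"
      "\<And>k. \<tau> - 1 / real (Suc k) \<le> norm (adj T (z k))" by metis
    have "(\<lambda>k. norm (adj T (z k))) \<longlonglongrightarrow> \<tau>"
    proof (rule tendsto_of_lower_bound_tendsto[OF z(3)])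
      show "(\<lambda>k. \<tau> - 1 / real (Suc k)) \<longlonglongrightarrow> \<tau>"
        using tendsto_diff[OF tendsto_const LIMSEQ_Suc[OF lim_1_over_n]] by force
      show "norm (adj T (z k)) \<le> \<tau>" for k using S\<tau>[OF z(1)] z(2) by simp
    qed
    then have "(\<lambda>k. norm (op_power T n (z k))) \<longlonglongrightarrow> \<tau> ^ n"
      by (intro paranormal_power_norming_sequence[OF ad adad pr para M \<tau>b(2) T\<tau> z(1,2)])
    then have "\<tau> ^ n \<le> b ^ n"
      by (rule LIMSEQ_le_const2) (use b(2)[OF z(1)] z(2) in auto)
    moreover have "b ^ n < \<tau> ^ n" using \<tau>b b(1) n by (intro power_strict_mono) auto
    ultimately show False by simp
  qed
  then show ?thesis using T\<tau>[OF x] by (meson mult_right_mono norm_ge_zero order_trans)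
qed simp

section \<open>Spectral subspaces of a normal operator\<close>

lemma op_power_commute:
  fixes A N :: "'a::real_normed_vector \<Rightarrow>\<^sub>L 'a"
  assumes "\<And>x. N (A x) = A (N x)"
  shows "N (op_power A k x) = op_power A k (N x)"
  by (induction k) (simp_all add: assms)

lemma adjoint_pair_op_power:
  assumes "adjoint_pair T S"
  shows "adjoint_pair (op_power T k) (op_power S k)"
proof (induction k)
  case (Suc k)
  have "inner (op_power T (Suc k) x) y = inner x (op_power S (Suc k) y)" for x y
    using Suc assms unfolding op_power_Suc_right[of S] by (simp add: adjoint_pair_def)
  then show ?case unfolding adjoint_pair_def by blast
qed (simp add: adjoint_pair_def)

lemma normal_norm_eq:
  fixes N N' :: "'a::real_inner \<Rightarrow>\<^sub>L 'a"
  assumes ad: "adjoint_pair N N'" and com: "\<And>x. N (N' x) = N' (N x)"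
  shows "norm (N x) = norm (N' x)"
proof -
  have "inner (N x) (N x) = inner (N' x) (N' x)"
    using ad adjoint_pair_sym[OF ad] com by (simp add: adjoint_pair_def)
  then show ?thesis by (simp add: norm_eq_sqrt_inner)
qed

lemma normal_power_norm_eq:
  fixes N N' :: "'a::real_inner \<Rightarrow>\<^sub>L 'a"
  assumes ad: "adjoint_pair N N'" and com: "\<And>x. N (N' x) = N' (N x)"
  shows "norm (op_power N k x) = norm (op_power N' k x)"
proof (induction k arbitrary: x)
  case (Suc k)
  have "norm (op_power N (Suc k) x) = norm (N' (op_power N k x))"
    using normal_norm_eq[OF assms] by simp
  also have "\<dots> = norm (op_power N k (N' x))" by (simp only: op_power_commute[OF com[symmetric]])
  finally show ?case unfolding op_power_Suc_right[of N'] by (simp only: Suc.IH)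
qed simp

text \<open>
  The ratios of a log-convex sequence increase, so an initial ratio above \<open>c\<close> would force
  growth faster than \<open>c ^ k\<close>.
\<close>

lemma log_convex_ratio_le:
  fixes a :: "nat \<Rightarrow> real"
  assumes nonneg: "\<And>k. a k \<ge> 0" and conv: "\<And>k. (a (Suc k))\<^sup>2 \<le> a k * a (Suc (Suc k))"
    and bound: "\<And>k. a k \<le> K * c ^ k" and "c \<ge> 0"
  shows "a 1 \<le> c * a 0"
proof (rule ccontr)
  assume less: "\<not> a 1 \<le> c * a 0"
  have a0: "a 0 > 0"
  proof (rule ccontr)
    assume "\<not> a 0 > 0"
    then have "a 0 = 0" using nonneg[of 0] by simp
    then show False using conv[of 0] less by simp
  qed
  define q where "q = a 1 / a 0"
  have q: "q > c" using less a0 by (simp add: q_def field_simps)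
  have step: "a k > 0 \<and> q * a k \<le> a (Suc k)" for k
  proof (induction k)
    case 0
    then show ?case using a0 by (simp add: q_def)
  next
    case (Suc k)
    have "0 < q * a k" using q \<open>c \<ge> 0\<close> Suc by simp
    then have pos: "a (Suc k) > 0" using Suc by linarith
    have "a k * (q * a (Suc k)) = (q * a k) * a (Suc k)" by simp
    also have "\<dots> \<le> a (Suc k) * a (Suc k)" using Suc pos by (intro mult_right_mono) auto
    also have "\<dots> \<le> a k * a (Suc (Suc k))" using conv[of k] by (simp add: power2_eq_square)
    finally show ?case using Suc pos by simp
  qed
  have grow: "q ^ k * a 0 \<le> a k" for k
  proof (induction k)
    case (Suc k)
    have "q ^ Suc k * a 0 \<le> q * a k" using Suc q \<open>c \<ge> 0\<close> by (simp add: mult.assoc mult_left_mono)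
    then show ?case using step[of k] by linarith
  qed simp
  show False
  proof (cases "c = 0")
    case True
    then show False using bound[of 1] less by simp
  next
    case False
    then have "c > 0" using \<open>c \<ge> 0\<close> by simp
    then obtain k where k: "K / a 0 < (q / c) ^ k"
      using real_arch_pow[of "q / c" "K / a 0"] q by auto
    then have "K * c ^ k < q ^ k * a 0"
      using a0 \<open>c > 0\<close> by (simp add: power_divide field_simps)
    then show False using grow[of k] bound[of k] by linarith
  qed
qed

text \<open>
  For normal \<open>N\<close> this is the range of the spectral projection of \<open>|N|\<close> for
  \<open>{0..c}\<close>. The growth condition defines it without spectral measures and makes its
  invariance under operators commuting with \<open>N\<close> visible.
\<close>

definition spectral_subspace :: "('a::real_normed_vector \<Rightarrow>\<^sub>L 'a) \<Rightarrow> real \<Rightarrow> 'a set" where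
  "spectral_subspace N c = {x. \<forall>k. norm (op_power N k x) \<le> c ^ k * norm x}"

lemma closed_spectral_subspace: "closed (spectral_subspace N c)"
  unfolding spectral_subspace_def
  by (intro closed_Collect_all closed_Collect_le continuous_intros)

lemma spectral_subspace_norm_le: "x \<in> spectral_subspace N c \<Longrightarrow> norm (N x) \<le> c * norm x"
  unfolding spectral_subspace_def by (auto dest: spec[of _ 1])

lemma spectral_subspace_mono:
  assumes "0 \<le> c" "c \<le> d"
  shows "spectral_subspace N c \<subseteq> spectral_subspace N d"
proof
  fix x assume x: "x \<in> spectral_subspace N c"
  have "norm (op_power N k x) \<le> d ^ k * norm x" for k
  proof -
    have "norm (op_power N k x) \<le> c ^ k * norm x" using x by (simp add: spectral_subspace_def)
    also have "\<dots> \<le> d ^ k * norm x" using assms by (intro mult_right_mono power_mono) auto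
    finally show ?thesis .
  qed
  then show "x \<in> spectral_subspace N d" by (simp add: spectral_subspace_def)
qed

lemma op_power_norm_le_on:
  fixes A :: "'a::real_normed_vector \<Rightarrow>\<^sub>L 'a"
  assumes "c \<ge> 0" "\<And>x. x \<in> M \<Longrightarrow> A x \<in> M" "\<And>x. x \<in> M \<Longrightarrow> norm (A x) \<le> c * norm x" "x \<in> M"
  shows "norm (op_power A k x) \<le> c ^ k * norm x"
  using assms(4)
proof (induction k arbitrary: x)
  case (Suc k)
  have "norm (op_power A (Suc k) x) \<le> c ^ k * norm (A x)"
    unfolding op_power_Suc_right by (rule Suc.IH[OF assms(2)[OF Suc.prems]])
  also have "\<dots> \<le> c ^ k * (c * norm x)" using assms(1,3) Suc.prems by (intro mult_left_mono) auto
  finally show ?case by (simp add: mult.commute mult.left_commute)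
qed simp

lemma spectral_subspace_UNIV:
  assumes "norm N \<le> c"
  shows "spectral_subspace N c = UNIV"
proof -
  have c: "c \<ge> 0" using assms norm_ge_zero order_trans by blast
  have "norm (N x) \<le> c * norm x" for x
    using norm_blinfun[of N x] mult_right_mono[OF assms norm_ge_zero[of x]] by linarith
  then have "norm (op_power N k x) \<le> c ^ k * norm x" for k x
    using op_power_norm_le_on[OF c, of UNIV N x k] by simp
  then show ?thesis by (auto simp: spectral_subspace_def)
qed

context
  fixes N N' :: "'a::complex_hilbert_space \<Rightarrow>\<^sub>L 'a" and c :: real
  assumes ad: "adjoint_pair N N'" and com: "\<And>x. N (N' x) = N' (N x)" and c: "c \<ge> 0"
begin

text \<open>
  The constant \<open>K\<close> is harmless by log-convexity. Sums, and images under commuting operators,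
  satisfy the growth condition at first only with such a constant.
\<close>

lemma spectral_subspaceI:
  assumes "\<And>k. norm (op_power N k x) \<le> K * c ^ k"
  shows "x \<in> spectral_subspace N c"
proof -
  have ratio: "norm (op_power N (Suc j) x) \<le> c * norm (op_power N j x)" for j
  proof -
    define a where "a k = norm (op_power N (k + j) x)" for k
    have "a 1 \<le> c * a 0"
    proof (rule log_convex_ratio_le[where K = "K * c ^ j"])
      show "(a (Suc k))\<^sup>2 \<le> a k * a (Suc (Suc k))" for k
      proof -
        define w where "w = op_power N (k + j) x"
        have "(norm (N w))\<^sup>2 = inner w (N' (N w))"
          using ad by (simp add: adjoint_pair_def power2_norm_eq_inner)
        also have "\<dots> \<le> norm w * norm (N' (N w))" by (rule norm_cauchy_schwarz)
        finally show ?thesis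
          using normal_norm_eq[OF ad com, of "N w"] by (simp add: a_def w_def)
      qed
      show "a k \<le> K * c ^ j * c ^ k" for k
        using assms[of "k + j"] by (simp add: a_def power_add mult.commute mult.left_commute)
    qed (simp_all add: a_def c)
    then show ?thesis by (simp add: a_def)
  qed
  have "norm (op_power N k x) \<le> c ^ k * norm x" for k
  proof (induction k)
    case (Suc k)
    have "c * norm (op_power N k x) \<le> c * (c ^ k * norm x)" using Suc c by (rule mult_left_mono)
    then show ?case using ratio[of k] by (simp add: mult.assoc)
  qed simp
  then show ?thesis by (simp add: spectral_subspace_def)
qed

lemma subspace_spectral_subspace: "subspace (spectral_subspace N c)"
proof (rule subspaceI)
  show "0 \<in> spectral_subspace N c" by (simp add: spectral_subspace_def blinfun.zero_right)
  show "x + y \<in> spectral_subspace N c" if "x \<in> spectral_subspace N c" "y \<in> spectral_subspace N c" for x y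
  proof (rule spectral_subspaceI[where K = "norm x + norm y"])
    fix k
    have "norm (op_power N k (x + y)) \<le> norm (op_power N k x) + norm (op_power N k y)"
      by (simp add: blinfun.add_right norm_triangle_ineq)
    also have "\<dots> \<le> c ^ k * norm x + c ^ k * norm y"
      using that by (intro add_mono) (auto simp: spectral_subspace_def)
    finally show "norm (op_power N k (x + y)) \<le> (norm x + norm y) * c ^ k" by (simp add: algebra_simps)
  qed
  show "r *\<^sub>R x \<in> spectral_subspace N c" if "x \<in> spectral_subspace N c" for r x
    using that by (simp add: spectral_subspace_def blinfun.scaleR_right mult_left_mono mult.left_commute)
qed

lemma spectral_subspace_invariant:
  fixes T :: "'a \<Rightarrow>\<^sub>L 'a"
  assumes T: "\<And>y. N (T y) = T (N y)" and x: "x \<in> spectral_subspace N c"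
  shows "T x \<in> spectral_subspace N c"
proof (rule spectral_subspaceI[where K = "norm T * norm x"])
  fix k
  have "norm (op_power N k (T x)) = norm (T (op_power N k x))"
    by (simp only: op_power_commute[OF T[symmetric]])
  also have "\<dots> \<le> norm T * norm (op_power N k x)" by (rule norm_blinfun)
  also have "\<dots> \<le> norm T * (c ^ k * norm x)"
    using x by (intro mult_left_mono) (auto simp: spectral_subspace_def)
  finally show "norm (op_power N k (T x)) \<le> norm T * norm x * c ^ k"
    by (simp add: mult.commute mult.left_commute)
qed

text \<open>
  Powers of \<open>N\<close> and of its adjoint have the same norm on every vector, so commuting with the
  adjoint is as good as commuting with \<open>N\<close>.
\<close>

lemma spectral_subspace_invariant_adjoint:
  fixes S :: "'a \<Rightarrow>\<^sub>L 'a"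
  assumes S: "\<And>y. N' (S y) = S (N' y)" and x: "x \<in> spectral_subspace N c"
  shows "S x \<in> spectral_subspace N c"
proof (rule spectral_subspaceI[where K = "norm S * norm x"])
  fix k
  have "norm (op_power N k (S x)) = norm (S (op_power N' k x))"
    by (simp only: op_power_commute[OF S[symmetric]] normal_power_norm_eq[OF ad com])
  also have "\<dots> \<le> norm S * norm (op_power N' k x)" by (rule norm_blinfun)
  also have "\<dots> \<le> norm S * (c ^ k * norm x)"
    using x by (intro mult_left_mono) (auto simp: spectral_subspace_def normal_power_norm_eq[OF ad com])
  finally show "norm (op_power N k (S x)) \<le> norm S * norm x * c ^ k"
    by (simp add: mult.commute mult.left_commute)
qed

text \<open>
  With \<open>D\<close> the composition of \<open>N'\<close> and \<open>N\<close> and \<open>h t = max 0 (c\<^sup>2 - t)\<close>, the range of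
  \<open>h(D)\<close> lies in the spectral subspace, because \<open>t * (h t)\<^sup>2 \<le> c\<^sup>2 * (h t)\<^sup>2\<close> and \<open>N\<close>
  commutes with \<open>h(D)\<close>. Hence \<open>h(D) y = 0\<close> for \<open>y\<close> orthogonal to it, and
  \<open>c\<^sup>2 - t \<le> h t\<close> gives the bound.
\<close>

lemma spectral_subspace_orthogonal_norm_ge:
  assumes orth: "\<And>w. w \<in> spectral_subspace N c \<Longrightarrow> inner y w = 0"
  shows "c * norm y \<le> norm (N y)"
proof -
  define D where "D = N' o\<^sub>L N"
  have D: "positive_op D" unfolding D_def by (rule adjoint_pair_positive[OF ad])
  have ND: "N (D x) = D (N x)" for x by (simp add: D_def com)
  have DN: "inner (D x) x = (norm (N x))\<^sup>2" for x
    using adjoint_pair_sym[OF ad] by (simp add: D_def adjoint_pair_def power2_norm_eq_inner)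
  have Dform: "inner (D x) x \<le> norm D * (norm x)\<^sup>2" for x
  proof -
    have "inner (D x) x \<le> norm (D x) * norm x" by (rule norm_cauchy_schwarz)
    also have "\<dots> \<le> norm D * norm x * norm x" by (intro mult_right_mono norm_blinfun) auto
    finally show ?thesis by (simp add: power2_eq_square mult.assoc)
  qed
  define h where "h t = max 0 (c\<^sup>2 - t)" for t :: real
  have h: "continuous_on {0..} h" unfolding h_def by (intro continuous_intros)
  have hh: "continuous_on {0..} (\<lambda>t. h t * h t)" by (rule continuous_on_mult[OF h h])
  have thh: "continuous_on {0..} (\<lambda>t. t * (h t * h t))" by (intro continuous_intros hh)
  have cont1: "continuous_on {0..} (\<lambda>t. c\<^sup>2 * (h t * h t))" by (intro continuous_intros hh)
  have contr: "norm (N (op_fun h D v)) \<le> c * norm (op_fun h D v)" for v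
  proof (rule power2_le_imp_le)
    have "(norm (N (op_fun h D v)))\<^sup>2 = inner (D (op_fun h D v)) (op_fun h D v)" by (simp add: DN)
    also have "\<dots> = inner (op_fun h D (D (op_fun h D v))) v"
      using op_fun_symmetric[OF D h] by (simp add: symmetric_op_def)
    also have "op_fun h D (D (op_fun h D v)) = D (op_fun h D (op_fun h D v))"
      by (simp add: op_fun_commute[OF D h, of D])
    also have "\<dots> = op_fun (\<lambda>t. t * (h t * h t)) D v"
      by (simp add: op_fun_mult[OF D continuous_on_id hh] op_fun_ident[OF D] op_fun_mult[OF D h h])
    also have "inner (op_fun (\<lambda>t. t * (h t * h t)) D v) v \<le> inner (op_fun (\<lambda>t. c\<^sup>2 * (h t * h t)) D v) v"
    proof (rule op_fun_mono_on[OF D thh cont1 subspace_UNIV])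
      show "t * (h t * h t) \<le> c\<^sup>2 * (h t * h t)" for t
        by (cases "t \<le> c\<^sup>2") (auto simp: h_def max_def intro!: mult_right_mono)
    qed (use Dform in auto)
    also have "\<dots> = c\<^sup>2 * inner (op_fun h D (op_fun h D v)) v"
      by (simp add: op_fun_mult[OF D continuous_on_const hh] op_fun_const[OF D] op_fun_mult[OF D h h])
    also have "\<dots> = (c * norm (op_fun h D v))\<^sup>2"
      using op_fun_symmetric[OF D h] by (simp add: symmetric_op_def power_mult_distrib power2_norm_eq_inner)
    finally show "(norm (N (op_fun h D v)))\<^sup>2 \<le> (c * norm (op_fun h D v))\<^sup>2" .
  qed (use c in simp)
  have mem: "op_fun h D v \<in> spectral_subspace N c" for v
  proof -
    have "norm (op_power N k (op_fun h D v)) \<le> c ^ k * norm (op_fun h D v)" for k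
    proof (rule op_power_norm_le_on[OF c, of "range (blinfun_apply (op_fun h D))"])
      show "N x \<in> range (blinfun_apply (op_fun h D))" if "x \<in> range (blinfun_apply (op_fun h D))" for x
        using that op_fun_commute[OF D h ND] by auto
    qed (use contr in auto)
    then show ?thesis by (simp add: spectral_subspace_def)
  qed
  define z where "z = op_fun h D y"
  have "inner z z = inner y (op_fun h D z)"
    using op_fun_symmetric[OF D h] by (simp add: z_def symmetric_op_def)
  also have "\<dots> = 0" by (rule orth[OF mem])
  finally have "z = 0" by simp
  have "inner (op_fun (\<lambda>t. c\<^sup>2 - t) D y) y \<le> inner (op_fun h D y) y"
    by (rule op_fun_mono_on[OF D _ h subspace_UNIV, where \<tau> = "norm D"])
      (use Dform in \<open>auto simp: h_def intro!: continuous_intros\<close>)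
  also have "\<dots> = 0" using \<open>z = 0\<close> by (simp add: z_def)
  finally have "(c * norm y)\<^sup>2 \<le> (norm (N y))\<^sup>2"
    by (simp add: op_fun_const_minus[OF D continuous_on_id] op_fun_ident[OF D] inner_diff_left DN
        power_mult_distrib dot_square_norm)
  then show ?thesis by (rule power2_le_imp_le) simp
qed

end

section \<open>Comparing an operator with its adjoint on thin spectral layers\<close>

text \<open>
  Dividing by \<open>t ^ (n - 1)\<close> leaves \<open>u \<ge> t * (s / t) ^ n * v\<close>, to which Bernoulli's
  inequality applies.
\<close>

lemma thin_layer_lower_bound:
  fixes s t u :: real
  assumes st: "0 \<le> s" "s \<le> t" "t > 0" and n: "n > 0" and u: "s ^ n * v \<le> t ^ (n - 1) * u" and v: "v \<ge> 0"
  shows "(t - real n * (t - s)) * v \<le> u"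
proof -
  have "1 + real n * (s / t - 1) \<le> (1 + (s / t - 1)) ^ n"
    by (rule Bernoulli_inequality) (use st in simp)
  then have "t ^ n * (1 + real n * (s / t - 1)) \<le> t ^ n * (s / t) ^ n"
    using st by (intro mult_left_mono) auto
  also have "\<dots> = s ^ n" using st by (simp add: power_divide)
  finally have "t ^ n * (1 + real n * (s / t - 1)) * v \<le> s ^ n * v" using v by (rule mult_right_mono)
  moreover have "t ^ n * (1 + real n * (s / t - 1)) = t ^ (n - 1) * (t - real n * (t - s))"
    using n st by (simp add: power_eq_if field_simps)
  ultimately have "t ^ (n - 1) * ((t - real n * (t - s)) * v) \<le> t ^ (n - 1) * u"
    using u by (simp add: mult.assoc)
  then show ?thesis using st by simp
qed

text \<open>
  The space is \<open>E (R ^ n)\<close> with \<open>R\<close> large and is exhausted by the layers between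
  \<open>E ((j * e) ^ n)\<close> and \<open>E (((j + 1) * e) ^ n)\<close>. On each of them the squared norms of
  \<open>T v\<close> and \<open>S v\<close> differ by at most \<open>2 * n * e * R\<close> times the squared norm of \<open>v\<close>; as the
  layers are orthogonal and reduce \<open>T\<close>, the same bound holds for all vectors.
\<close>

lemma paranormal_power_normal_norm_eq:
  fixes T :: "'a::complex_hilbert_space \<Rightarrow>\<^sub>L 'a"
  assumes ad: "adjoint_pair T (adj T)" and adad: "adj (adj T) = T"
    and pr: "p > 0" "r > 0" and para: "absolute_paranormal p r T"
    and n: "n > 0"
    and normal: "\<And>x. op_power T n (op_power (adj T) n x) = op_power (adj T) n (op_power T n x)"
  shows "norm (T x) = norm (adj T x)"
proof -
  define S where "S = adj T"
  define N where "N = op_power T n"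
  define N' where "N' = op_power S n"
  define E where "E c = spectral_subspace N c" for c
  have adN: "adjoint_pair N N'" unfolding N_def N'_def S_def by (rule adjoint_pair_op_power[OF ad])
  have com: "N (N' x) = N' (N x)" for x using normal by (simp add: N_def N'_def S_def)
  have TN: "N (T y) = T (N y)" for y unfolding N_def by (simp add: op_power_commute)
  have SN: "N' (S y) = S (N' y)" for y unfolding N'_def by (simp add: op_power_commute)
  have E: "subspace (E c)" "closed (E c)" "\<And>y. y \<in> E c \<Longrightarrow> T y \<in> E c" "\<And>y. y \<in> E c \<Longrightarrow> S y \<in> E c"
    if "c \<ge> 0" for c
    unfolding E_def
    using subspace_spectral_subspace[OF adN com that] closed_spectral_subspace
      spectral_subspace_invariant[OF adN com that TN] spectral_subspace_invariant_adjoint[OF adN com that SN]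
    by blast+
  have Tle: "norm (T y) \<le> t * norm y" if t: "t \<ge> 0" and y: "y \<in> E (t ^ n)" for t y
    by (rule paranormal_norm_le_of_power[OF ad adad pr para, of "E (t ^ n)" n])
      (use E[of "t ^ n"] t y n spectral_subspace_norm_le in \<open>auto simp: S_def E_def N_def\<close>)
  have Sle: "norm (S y) \<le> t * norm y" if t: "t \<ge> 0" and y: "y \<in> E (t ^ n)" for t y
    by (rule adjoint_pair_norm_le_on[OF ad[folded S_def] t, of "E (t ^ n)"])
      (use E[of "t ^ n"] t y Tle in auto)
  \<comment> \<open>Squared norms, because they add up over orthogonal reducing subspaces.\<close>
  define gap where "gap y = \<bar>(norm (T y))\<^sup>2 - (norm (S y))\<^sup>2\<bar>" for y
  have layer: "gap v \<le> 2 * real n * (t - s) * t * (norm v)\<^sup>2"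
    if st: "0 \<le> s" "s \<le> t" "t > 0" and v: "v \<in> E (t ^ n)" and orth: "\<And>w. w \<in> E (s ^ n) \<Longrightarrow> inner v w = 0" for s t v
  proof -
    have Nv: "s ^ n * norm v \<le> norm (N v)"
      by (rule spectral_subspace_orthogonal_norm_ge[OF adN com]) (use st orth in \<open>auto simp: E_def\<close>)
    have low: "(t - real n * (t - s)) * norm v \<le> norm (A v)"
      if A: "\<And>y. y \<in> E (t ^ n) \<Longrightarrow> A y \<in> E (t ^ n)" "\<And>y. y \<in> E (t ^ n) \<Longrightarrow> norm (A y) \<le> t * norm y"
        "norm (op_power A n v) = norm (N v)" for A :: "'a \<Rightarrow>\<^sub>L 'a"
    proof (rule thin_layer_lower_bound[OF st n])
      have "norm (op_power A n v) = norm (op_power A (n - 1) (A v))"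
        using op_power_Suc_right[of A "n - 1" v] n by simp
      also have "\<dots> \<le> t ^ (n - 1) * norm (A v)"
        by (rule op_power_norm_le_on[of t "E (t ^ n)"]) (use st A v in auto)
      finally show "s ^ n * norm v \<le> t ^ (n - 1) * norm (A v)" using Nv A(3) by simp
    qed simp
    have tn: "t ^ n \<ge> 0" using st by simp
    define a where "a = norm (T v)"
    define b where "b = norm (S v)"
    have a: "(t - real n * (t - s)) * norm v \<le> a" "a \<le> t * norm v"
      unfolding a_def using st v by (intro low Tle E(3)[OF tn]; simp add: N_def)+
    have "norm (op_power S n v) = norm (N v)"
      using normal_norm_eq[OF adN com, of v] by (simp add: N'_def)
    then have b: "(t - real n * (t - s)) * norm v \<le> b" "b \<le> t * norm v"
      unfolding b_def using st v by (intro low Sle E(4)[OF tn]; simp)+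
    have "gap v = \<bar>a - b\<bar> * (a + b)"
      by (simp add: gap_def a_def b_def power2_eq_square square_diff_square_factored abs_mult)
    also have "\<dots> \<le> (real n * (t - s) * norm v) * (2 * (t * norm v))"
    proof (rule mult_mono)
      show "\<bar>a - b\<bar> \<le> real n * (t - s) * norm v"
        using a b by (simp add: abs_le_iff algebra_simps)
    qed (use a b st in \<open>auto simp: a_def b_def\<close>)
    finally show ?thesis by (simp add: power2_eq_square mult.commute mult.left_commute)
  qed
  have split_gap: "gap (u + v) \<le> gap u + gap v"
    if c: "c \<ge> 0" and u: "u \<in> E c" and orth: "\<And>w. w \<in> E c \<Longrightarrow> inner v w = 0" for u v c
  proof -
    have "inner (T u) (T v) = 0" "inner (S u) (S v) = 0"
      using orth[OF E(4)[OF c E(3)[OF c u]]] orth[OF E(3)[OF c E(4)[OF c u]]] ad adjoint_pair_sym[OF ad]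
      by (auto simp: adjoint_pair_def S_def inner_commute)
    then have "(norm (T (u + v)))\<^sup>2 = (norm (T u))\<^sup>2 + (norm (T v))\<^sup>2"
      "(norm (S (u + v)))\<^sup>2 = (norm (S u))\<^sup>2 + (norm (S v))\<^sup>2"
      by (simp_all add: power2_norm_eq_inner blinfun.add_right inner_add_left inner_add_right inner_commute)
    then show ?thesis by (simp add: gap_def)
  qed
  define R where "R = max 1 (norm N)"
  have R: "R \<ge> 1" "norm N \<le> R ^ n"
    using self_le_power[of R n] n by (auto simp: R_def)
  have grid: "gap y \<le> 2 * real n * e * R * (norm y)\<^sup>2"
    if e: "e > 0" and j: "real j * e \<le> R" and y: "y \<in> E ((real j * e) ^ n)" for e j y
    using j y
  proof (induction j arbitrary: y)
    case 0
    then have "T y = 0" "S y = 0" using Tle[of 0 y] Sle[of 0 y] by auto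
    then show ?case using e R by (simp add: gap_def)
  next
    case (Suc j)
    let ?s = "real j * e" and ?t = "real (Suc j) * e"
    have st: "0 \<le> ?s" "?s \<le> ?t" "?t > 0" "?t - ?s = e" using e by (simp_all add: algebra_simps add_pos_nonneg)
    then have sR: "?s \<le> R" using Suc.prems(1) by linarith
    have sn: "0 \<le> ?s ^ n" and tn: "0 \<le> ?t ^ n" using st by (auto intro: zero_le_power)
    obtain u where u: "u \<in> E (?s ^ n)" "\<And>w. w \<in> E (?s ^ n) \<Longrightarrow> inner (y - u) w = 0"
      by (rule orthogonal_projection[OF E(1,2)[OF sn]]) blast
    define v where "v = y - u"
    have "E (?s ^ n) \<subseteq> E (?t ^ n)"
      unfolding E_def by (rule spectral_subspace_mono[OF sn power_mono]) (use st in auto)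
    then have v: "v \<in> E (?t ^ n)"
      unfolding v_def using u(1) Suc.prems(2) by (intro subspace_diff[OF E(1)[OF tn]]) auto
    have orth: "inner v w = 0" if "w \<in> E (?s ^ n)" for w using u(2)[OF that] by (simp add: v_def)
    have "gap v \<le> 2 * real n * (?t - ?s) * ?t * (norm v)\<^sup>2"
      by (rule layer[OF st(1-3) v orth])
    also have "\<dots> \<le> 2 * real n * e * R * (norm v)\<^sup>2"
      using Suc.prems(1) e unfolding st(4) by (intro mult_right_mono mult_left_mono) auto
    finally have "gap v \<le> 2 * real n * e * R * (norm v)\<^sup>2" .
    moreover have "gap u \<le> 2 * real n * e * R * (norm u)\<^sup>2" using Suc.IH[OF sR u(1)] .
    moreover have "gap (u + v) \<le> gap u + gap v" by (rule split_gap[OF sn u(1) orth])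
    moreover have "(norm (u + v))\<^sup>2 = (norm u)\<^sup>2 + (norm v)\<^sup>2"
      using orth[OF u(1)] by (simp add: power2_norm_eq_inner inner_add_left inner_add_right inner_commute)
    ultimately show ?case by (simp add: v_def algebra_simps)
  qed
  have "gap x \<le> 0"
  proof (rule LIMSEQ_le_const)
    have "(\<lambda>m. 2 * real n * R * R * (norm x)\<^sup>2 * (1 / real (Suc m))) \<longlonglongrightarrow> 2 * real n * R * R * (norm x)\<^sup>2 * 0"
      by (intro tendsto_mult tendsto_const LIMSEQ_Suc[OF lim_1_over_n])
    then show "(\<lambda>m. 2 * real n * (R / real (Suc m)) * R * (norm x)\<^sup>2) \<longlonglongrightarrow> 0" by (simp add: mult.commute mult.left_commute)
    have "x \<in> E ((real (Suc m) * (R / real (Suc m))) ^ n)" for m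
      using spectral_subspace_UNIV[OF R(2)] by (simp add: E_def)
    then have "gap x \<le> 2 * real n * (R / real (Suc m)) * R * (norm x)\<^sup>2" for m
      using R by (intro grid[where j = "Suc m"]) (auto simp del: of_nat_Suc)
    then show "\<exists>M. \<forall>m\<ge>M. gap x \<le> 2 * real n * (R / real (Suc m)) * R * (norm x)\<^sup>2" by blast
  qed
  then have "(norm (T x))\<^sup>2 = (norm (adj T x))\<^sup>2" by (simp add: gap_def S_def)
  then show ?thesis by simp
qed

text \<open>
  Polarisation of the form of \<open>S T - T S\<close>.
\<close>

lemma normal_of_norm_eq:
  fixes T S :: "'a::real_inner \<Rightarrow>\<^sub>L 'a"
  assumes ad: "adjoint_pair T S" and eq: "\<And>x. norm (T x) = norm (S x)"
  shows "S o\<^sub>L T = T o\<^sub>L S"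
proof (rule blinfun_eqI)
  define D where "D = (S o\<^sub>L T) - (T o\<^sub>L S)"
  have D: "inner (D x) y = inner (T x) (T y) - inner (S x) (S y)" for x y
    using ad adjoint_pair_sym[OF ad] by (simp add: D_def blinfun.diff_left inner_diff_left adjoint_pair_def)
  have form: "inner (D x) x = 0" for x
    using eq[of x] by (simp add: D dot_square_norm)
  have "inner (D x) y = 0" for x y
  proof -
    have "inner (D y) x = inner (D x) y" by (simp only: D inner_commute[of "T y"] inner_commute[of "S y"])
    moreover have "inner (D (x + y)) (x + y) = inner (D x) x + inner (D x) y + (inner (D y) x + inner (D y) y)"
      by (simp add: blinfun.add_right inner_add_left inner_add_right)
    ultimately show ?thesis by (simp add: form)
  qed
  then have "D x = 0" for x using inner_eq_zero_iff by blast
  then show "(S o\<^sub>L T) x = (T o\<^sub>L S) x" for x by (simp add: D_def blinfun.diff_left)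
qed

theorem theorem4p1:
  fixes T :: "'a::complex_hilbert_space \<Rightarrow>\<^sub>L 'a" and p r :: real
  assumes "complex_linear (blinfun_apply T)"
    and "p > 0" and "r > 0"
    and "absolute_paranormal p r T"
    and "\<exists>n::nat. n > 0 \<and> normal_op (op_power T n)"
  shows "normal_op T"
proof -
  have ad: "adjoint_pair T (adj T)" using inner_adj(1)[OF assms(1)] by (simp add: adjoint_pair_def)
  have adad: "adj (adj T) = T" by (rule inner_adj(2)[OF assms(1)])
  obtain n where n: "n > 0" "normal_op (op_power T n)" using assms(5) by blast
  have "complex_linear (blinfun_apply (op_power T k))" for k
    using assms(1) by (induction k) (auto simp: complex_linear_def)
  then have "inner x (adj (op_power T n) y) = inner x (op_power (adj T) n y)" for x y
    using inner_adj(1)[of "op_power T n"] adjoint_pair_op_power[OF ad, of n] by (simp add: adjoint_pair_def)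
  then have "adj (op_power T n) = op_power (adj T) n"
    by (intro blinfun_eqI) (use vector_eq_ldot in blast)
  then have "op_power (adj T) n o\<^sub>L op_power T n = op_power T n o\<^sub>L op_power (adj T) n"
    using n(2) by (simp add: normal_op_def)
  then have "op_power T n (op_power (adj T) n x) = op_power (adj T) n (op_power T n x)" for x
    by (metis blinfun_apply_blinfun_compose)
  then have "norm (T x) = norm (adj T x)" for x
    by (rule paranormal_power_normal_norm_eq[OF ad adad assms(2-4) n(1)])
  then show ?thesis unfolding normal_op_def by (rule normal_of_norm_eq[OF ad])
qed

end
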